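(* There is a bicategory whose objects are diffeological groupoids, whose morphisms are diffeological bibundles with the balanced tensor product as composition, and whose 2-morphisms are biequivariant smooth maps.
   Context: Diffeology. A Euclidean domain is an open subset of some $\mathbb{R}^m$, $m\geq 0$. A diffeology on a set $X$ is a set of functions from Euclidean domains to $X$, called plots, such that: all constant functions are plots; if $\alpha:U\to X$ is a plot and $h:V\to U$ is a smooth map between Euclidean domains, then $\alpha\circ h$ is a plot; a function $\alpha:U\to X$ whose restriction to each member of some open cover of $U$ is a plot is itself a plot. A diffeological space is a set with a diffeology. A function $f$ between diffeological spaces is smooth if $f\circ\alpha$ is a plot for every plot $\alpha$. The plots of a product are the functions whose two components are plots; the plots of a subset are the functions into it that are plots of the ambient space; the fibred product $X\times_Z^{f,g}Y=\{(x,y)\in X\times Y: f(x)=g(y)\}$ has the subset diffeology of the product. The plots of a quotient $X/{\sim}$ are the functions that locally lift along the projection to plots of $X$. Diffeological groupoids. A diffeological groupoid $G\rightrightarrows G_0$ is a groupoid whose object set $G_0$ and arrow set $G$ are diffeological spaces such that source $\mathrm{src}$, target $\mathrm{trg}$, unit $x\mapsto \mathrm{id}_x$, inversion and composition $G\times_{G_0}^{\mathrm{src},\mathrm{trg}}G\to G$, $(g,h)\mapsto g\circ h$, are smooth. Actions. A smooth left action of $G$ on a diffeological space $X$ along a smooth map $l_X:X\to G_0$ (left moment map) is a smooth map $G\times_{G_0}^{\mathrm{src},l_X}X\to X$, $(g,x)\mapsto gx$, with $l_X(gx)=\mathrm{trg}(g)$, $\mathrm{id}_{l_X(x)}x=x$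 and $h(gx)=(h\circ g)x$ whenever defined. A smooth right action of $H$ on $X$ along $r_X:X\to H_0$ (right moment map) is a smooth map $X\times_{H_0}^{r_X,\mathrm{trg}}H\to X$, $(x,h)\mapsto xh$, with $r_X(xh)=\mathrm{src}(h)$, $x\,\mathrm{id}_{r_X(x)}=x$ and $(xh)h'=x(h\circ h')$ whenever defined. Bibundles. A diffeological $(G,H)$-bibundle is a diffeological space $X$ with a smooth left $G$-action along $l_X$ and a smooth right $H$-action along $r_X$ such that $l_X(xh)=l_X(x)$, $r_X(gx)=r_X(x)$ and $(gx)h=g(xh)$ whenever defined. It is regarded as a morphism between $G$ and $H$. A smooth map $\varphi:X\to Y$ between $(G,H)$-bibundles is biequivariant if $l_Y\circ\varphi=l_X$, $r_Y\circ\varphi=r_X$, $\varphi(gx)=g\varphi(x)$ and $\varphi(xh)=\varphi(x)h$ whenever defined; these are composed as functions. Balanced tensor product (composition of bibundles). For a $(G,H)$-bibundle $X$ and an $(H,K)$-bibundle $Y$, $X\otimes_H Y$ is the quotient (with quotient diffeology) of $X\times_{H_0}^{r_X,l_Y}Y$ by the relation $(x,y)\sim(xh,h^{-1}y)$; the class of $(x,y)$ is $x\otimes y$. It is a $(G,K)$-bibundle with moment maps $x\otimes y\mapsto l_X(x)$ and $x\otimes y\mapsto r_Y(y)$ and actions $g(x\otimes y)=gx\otimes y$, $(x\otimes y)k=x\otimes yk$. The identity morphism of $G$ is the identity bibundle: the arrow space $G$ with left moment map $\mathrm{trg}$, right moment map $\mathrm{src}$, and both actions given by composition. *)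

theory Defs
  imports "HOL-Analysis.Analysis"
begin

section \<open>Smooth maps between Euclidean domains\<close>

text \<open>
  Since plots of all dimensions occur together, \<open>\<real>\<^sup>m\<close> is the library space \<^term>\<open>Euclidean_space m\<close>
  of sequences vanishing from index \<open>m\<close> on. A Euclidean domain is a set \<open>U\<close> with
  \<^term>\<open>openin (Euclidean_space m) U\<close>; the case \<open>m = 0\<close> is included.
\<close>

fun Ck_on :: "nat \<Rightarrow> nat \<Rightarrow> (nat \<Rightarrow> real) set \<Rightarrow> ((nat \<Rightarrow> real) \<Rightarrow> real) \<Rightarrow> bool" where
  "Ck_on 0 m U f \<longleftrightarrow> continuous_map (subtopology (Euclidean_space m) U) euclideanreal f"
| "Ck_on (Suc k) m U f \<longleftrightarrow>
     continuous_map (subtopology (Euclidean_space m) U) euclideanreal f \<and>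
     (\<forall>i<m. \<exists>f'. Ck_on k m U f' \<and>
        (\<forall>x\<in>U. ((\<lambda>t. f (x(i := t))) has_real_derivative f' x) (at (x i))))"

definition smooth_euclidean ::
  "nat \<Rightarrow> (nat \<Rightarrow> real) set \<Rightarrow> nat \<Rightarrow> (nat \<Rightarrow> real) set \<Rightarrow> ((nat \<Rightarrow> real) \<Rightarrow> nat \<Rightarrow> real) \<Rightarrow> bool" where
  "smooth_euclidean n V m U h \<longleftrightarrow> h \<in> V \<rightarrow> U \<and> (\<forall>j<m. \<forall>k. Ck_on k n V (\<lambda>v. h v j))"


section \<open>Diffeological spaces\<close>

text \<open>
  \<open>plots X m U\<close> is the set of plots with domain \<open>U \<subseteq> \<real>\<^sup>m\<close>. Here and below, functions with a
  prescribed domain are extensional (\<^const>\<open>undefined\<close> outside of it), so that equality of HOL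
  functions is equality of functions on that domain.
\<close>

record 'a dspace =
  points :: "'a set"
  plots :: "nat \<Rightarrow> (nat \<Rightarrow> real) set \<Rightarrow> ((nat \<Rightarrow> real) \<Rightarrow> 'a) set"

locale diffeological_space =
  fixes X :: "'a dspace"
  assumes plot_domain:
      "\<alpha> \<in> plots X m U \<Longrightarrow> openin (Euclidean_space m) U \<and> \<alpha> \<in> U \<rightarrow>\<^sub>E points X"
    and plot_const:
      "openin (Euclidean_space m) U \<Longrightarrow> x \<in> points X \<Longrightarrow> (\<lambda>u\<in>U. x) \<in> plots X m U"
    and plot_compose:
      "\<alpha> \<in> plots X m U \<Longrightarrow> openin (Euclidean_space n) V \<Longrightarrow> smooth_euclidean n V m U h
        \<Longrightarrow> (\<lambda>v\<in>V. \<alpha> (h v)) \<in> plots X n V"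
    and plot_local:
      "openin (Euclidean_space m) U \<Longrightarrow> \<alpha> \<in> U \<rightarrow>\<^sub>E points X \<Longrightarrow> \<Union>\<W> = U
        \<Longrightarrow> (\<And>W. W \<in> \<W> \<Longrightarrow> openin (Euclidean_space m) W \<and> restrict \<alpha> W \<in> plots X m W)
        \<Longrightarrow> \<alpha> \<in> plots X m U"

definition smooth :: "'a dspace \<Rightarrow> 'b dspace \<Rightarrow> ('a \<Rightarrow> 'b) \<Rightarrow> bool" where
  "smooth X Y f \<longleftrightarrow> f \<in> points X \<rightarrow>\<^sub>E points Y \<and>
     (\<forall>m U. \<forall>\<alpha>\<in>plots X m U. (\<lambda>u\<in>U. f (\<alpha> u)) \<in> plots Y m U)"

definition product_dspace :: "'a dspace \<Rightarrow> 'b dspace \<Rightarrow> ('a \<times> 'b) dspace" where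
  "product_dspace X Y =
     \<lparr>points = points X \<times> points Y,
      plots = \<lambda>m U. {\<gamma> \<in> U \<rightarrow>\<^sub>E points X \<times> points Y.
        (\<lambda>u\<in>U. fst (\<gamma> u)) \<in> plots X m U \<and> (\<lambda>u\<in>U. snd (\<gamma> u)) \<in> plots Y m U}\<rparr>"

definition subset_dspace :: "'a dspace \<Rightarrow> 'a set \<Rightarrow> 'a dspace" where
  "subset_dspace X A = \<lparr>points = A, plots = \<lambda>m U. {\<alpha> \<in> plots X m U. \<alpha> ` U \<subseteq> A}\<rparr>"

definition fibre_product ::
  "'a dspace \<Rightarrow> ('a \<Rightarrow> 'c) \<Rightarrow> ('b \<Rightarrow> 'c) \<Rightarrow> 'b dspace \<Rightarrow> ('a \<times> 'b) dspace" where
  "fibre_product X f g Y =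
     subset_dspace (product_dspace X Y) {(x, y). x \<in> points X \<and> y \<in> points Y \<and> f x = g y}"

definition quotient_dspace :: "'a dspace \<Rightarrow> ('a \<times> 'a) set \<Rightarrow> 'a set dspace" where
  "quotient_dspace X R =
     \<lparr>points = points X // R,
      plots = \<lambda>m U. {\<alpha> \<in> U \<rightarrow>\<^sub>E points X // R. openin (Euclidean_space m) U \<and>
        (\<forall>u\<in>U. \<exists>W. openin (Euclidean_space m) W \<and> u \<in> W \<and> W \<subseteq> U \<and>
          (\<exists>\<beta>\<in>plots X m W. \<forall>w\<in>W. \<alpha> w = R `` {\<beta> w}))}\<rparr>"


section \<open>Diffeological groupoids\<close>

text \<open>\<open>gcomp G (g, h)\<close> is \<open>g \<circ> h\<close>, defined when the source of \<open>g\<close> is the target of \<open>h\<close>.\<close>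

record ('o, 'a) dgroupoid =
  obs :: "'o dspace"
  arrs :: "'a dspace"
  gsrc :: "'a \<Rightarrow> 'o"
  gtrg :: "'a \<Rightarrow> 'o"
  gid :: "'o \<Rightarrow> 'a"
  ginv :: "'a \<Rightarrow> 'a"
  gcomp :: "'a \<times> 'a \<Rightarrow> 'a"

locale diffeological_groupoid =
  fixes G :: "('o, 'a) dgroupoid"
  assumes obs: "diffeological_space (obs G)"
    and arrs: "diffeological_space (arrs G)"
    and smooth_src: "smooth (arrs G) (obs G) (gsrc G)"
    and smooth_trg: "smooth (arrs G) (obs G) (gtrg G)"
    and smooth_id: "smooth (obs G) (arrs G) (gid G)"
    and smooth_inv: "smooth (arrs G) (arrs G) (ginv G)"
    and smooth_comp:
      "smooth (fibre_product (arrs G) (gsrc G) (gtrg G) (arrs G)) (arrs G) (gcomp G)"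
    and src_id: "x \<in> points (obs G) \<Longrightarrow> gsrc G (gid G x) = x"
    and trg_id: "x \<in> points (obs G) \<Longrightarrow> gtrg G (gid G x) = x"
    and src_comp:
      "g \<in> points (arrs G) \<Longrightarrow> h \<in> points (arrs G) \<Longrightarrow> gsrc G g = gtrg G h
        \<Longrightarrow> gsrc G (gcomp G (g, h)) = gsrc G h"
    and trg_comp:
      "g \<in> points (arrs G) \<Longrightarrow> h \<in> points (arrs G) \<Longrightarrow> gsrc G g = gtrg G h
        \<Longrightarrow> gtrg G (gcomp G (g, h)) = gtrg G g"
    and comp_assoc:
      "g \<in> points (arrs G) \<Longrightarrow> h \<in> points (arrs G) \<Longrightarrow> k \<in> points (arrs G)
        \<Longrightarrow> gsrc G g = gtrg G h \<Longrightarrow> gsrc G h = gtrg G k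
        \<Longrightarrow> gcomp G (gcomp G (g, h), k) = gcomp G (g, gcomp G (h, k))"
    and id_left: "g \<in> points (arrs G) \<Longrightarrow> gcomp G (gid G (gtrg G g), g) = g"
    and id_right: "g \<in> points (arrs G) \<Longrightarrow> gcomp G (g, gid G (gsrc G g)) = g"
    and src_inv: "g \<in> points (arrs G) \<Longrightarrow> gsrc G (ginv G g) = gtrg G g"
    and trg_inv: "g \<in> points (arrs G) \<Longrightarrow> gtrg G (ginv G g) = gsrc G g"
    and inv_left: "g \<in> points (arrs G) \<Longrightarrow> gcomp G (ginv G g, g) = gid G (gsrc G g)"
    and inv_right: "g \<in> points (arrs G) \<Longrightarrow> gcomp G (g, ginv G g) = gid G (gtrg G g)"


section \<open>Actions and bibundles\<close>

locale smooth_left_action =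
  fixes G :: "('o, 'a) dgroupoid" and X :: "'x dspace"
    and l :: "'x \<Rightarrow> 'o" and act :: "'a \<times> 'x \<Rightarrow> 'x"
  assumes smooth_moment: "smooth X (obs G) l"
    and smooth_act: "smooth (fibre_product (arrs G) (gsrc G) l X) X act"
    and moment_act:
      "g \<in> points (arrs G) \<Longrightarrow> x \<in> points X \<Longrightarrow> gsrc G g = l x \<Longrightarrow> l (act (g, x)) = gtrg G g"
    and act_id: "x \<in> points X \<Longrightarrow> act (gid G (l x), x) = x"
    and act_act:
      "g \<in> points (arrs G) \<Longrightarrow> h \<in> points (arrs G) \<Longrightarrow> x \<in> points X
        \<Longrightarrow> gsrc G g = l x \<Longrightarrow> gsrc G h = gtrg G g
        \<Longrightarrow> act (h, act (g, x)) = act (gcomp G (h, g), x)"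

locale smooth_right_action =
  fixes H :: "('o, 'a) dgroupoid" and X :: "'x dspace"
    and r :: "'x \<Rightarrow> 'o" and act :: "'x \<times> 'a \<Rightarrow> 'x"
  assumes smooth_moment: "smooth X (obs H) r"
    and smooth_act: "smooth (fibre_product X r (gtrg H) (arrs H)) X act"
    and moment_act:
      "x \<in> points X \<Longrightarrow> h \<in> points (arrs H) \<Longrightarrow> r x = gtrg H h \<Longrightarrow> r (act (x, h)) = gsrc H h"
    and act_id: "x \<in> points X \<Longrightarrow> act (x, gid H (r x)) = x"
    and act_act:
      "x \<in> points X \<Longrightarrow> h \<in> points (arrs H) \<Longrightarrow> h' \<in> points (arrs H)
        \<Longrightarrow> r x = gtrg H h \<Longrightarrow> gsrc H h = gtrg H h'
        \<Longrightarrow> act (act (x, h), h') = act (x, gcomp H (h, h'))"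

record ('og, 'ag, 'oh, 'ah, 'x) bibundle =
  lgrpd :: "('og, 'ag) dgroupoid"
  rgrpd :: "('oh, 'ah) dgroupoid"
  total :: "'x dspace"
  lmom :: "'x \<Rightarrow> 'og"
  rmom :: "'x \<Rightarrow> 'oh"
  lact :: "'ag \<times> 'x \<Rightarrow> 'x"
  ract :: "'x \<times> 'ah \<Rightarrow> 'x"

locale diffeological_bibundle =
  fixes X :: "('og, 'ag, 'oh, 'ah, 'x) bibundle"
  assumes lgrpd: "diffeological_groupoid (lgrpd X)"
    and rgrpd: "diffeological_groupoid (rgrpd X)"
    and total: "diffeological_space (total X)"
    and left_action: "smooth_left_action (lgrpd X) (total X) (lmom X) (lact X)"
    and right_action: "smooth_right_action (rgrpd X) (total X) (rmom X) (ract X)"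
    and lmom_ract:
      "x \<in> points (total X) \<Longrightarrow> h \<in> points (arrs (rgrpd X)) \<Longrightarrow> rmom X x = gtrg (rgrpd X) h
        \<Longrightarrow> lmom X (ract X (x, h)) = lmom X x"
    and rmom_lact:
      "g \<in> points (arrs (lgrpd X)) \<Longrightarrow> x \<in> points (total X) \<Longrightarrow> gsrc (lgrpd X) g = lmom X x
        \<Longrightarrow> rmom X (lact X (g, x)) = rmom X x"
    and lact_ract:
      "g \<in> points (arrs (lgrpd X)) \<Longrightarrow> x \<in> points (total X) \<Longrightarrow> h \<in> points (arrs (rgrpd X))
        \<Longrightarrow> gsrc (lgrpd X) g = lmom X x \<Longrightarrow> rmom X x = gtrg (rgrpd X) h
        \<Longrightarrow> ract X (lact X (g, x), h) = lact X (g, ract X (x, h))"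

definition identity_bibundle :: "('o, 'a) dgroupoid \<Rightarrow> ('o, 'a, 'o, 'a, 'a) bibundle" where
  "identity_bibundle G =
     \<lparr>lgrpd = G, rgrpd = G, total = arrs G, lmom = gtrg G, rmom = gsrc G,
      lact = gcomp G, ract = gcomp G\<rparr>"


section \<open>Biequivariant maps\<close>

record ('og, 'ag, 'oh, 'ah, 'x, 'y) bimap =
  bsrc :: "('og, 'ag, 'oh, 'ah, 'x) bibundle"
  btrg :: "('og, 'ag, 'oh, 'ah, 'y) bibundle"
  bfun :: "'x \<Rightarrow> 'y"

locale biequivariant_smooth_map =
  fixes \<phi> :: "('og, 'ag, 'oh, 'ah, 'x, 'y) bimap"
  assumes bsrc: "diffeological_bibundle (bsrc \<phi>)"
    and btrg: "diffeological_bibundle (btrg \<phi>)"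
    and same_lgrpd: "lgrpd (bsrc \<phi>) = lgrpd (btrg \<phi>)"
    and same_rgrpd: "rgrpd (bsrc \<phi>) = rgrpd (btrg \<phi>)"
    and smooth_bfun: "smooth (total (bsrc \<phi>)) (total (btrg \<phi>)) (bfun \<phi>)"
    and lmom_bfun: "x \<in> points (total (bsrc \<phi>)) \<Longrightarrow> lmom (btrg \<phi>) (bfun \<phi> x) = lmom (bsrc \<phi>) x"
    and rmom_bfun: "x \<in> points (total (bsrc \<phi>)) \<Longrightarrow> rmom (btrg \<phi>) (bfun \<phi> x) = rmom (bsrc \<phi>) x"
    and bfun_lact:
      "g \<in> points (arrs (lgrpd (bsrc \<phi>))) \<Longrightarrow> x \<in> points (total (bsrc \<phi>))
        \<Longrightarrow> gsrc (lgrpd (bsrc \<phi>)) g = lmom (bsrc \<phi>) x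
        \<Longrightarrow> bfun \<phi> (lact (bsrc \<phi>) (g, x)) = lact (btrg \<phi>) (g, bfun \<phi> x)"
    and bfun_ract:
      "x \<in> points (total (bsrc \<phi>)) \<Longrightarrow> h \<in> points (arrs (rgrpd (bsrc \<phi>)))
        \<Longrightarrow> rmom (bsrc \<phi>) x = gtrg (rgrpd (bsrc \<phi>)) h
        \<Longrightarrow> bfun \<phi> (ract (bsrc \<phi>) (x, h)) = ract (btrg \<phi>) (bfun \<phi> x, h)"

definition identity_bimap ::
  "('og, 'ag, 'oh, 'ah, 'x) bibundle \<Rightarrow> ('og, 'ag, 'oh, 'ah, 'x, 'x) bimap" where
  "identity_bimap X = \<lparr>bsrc = X, btrg = X, bfun = (\<lambda>x\<in>points (total X). x)\<rparr>"

text \<open>\<open>compose_bimap \<psi> \<phi>\<close> is \<open>\<psi> \<circ> \<phi>\<close>.\<close>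

definition compose_bimap ::
  "('og, 'ag, 'oh, 'ah, 'y, 'z) bimap \<Rightarrow> ('og, 'ag, 'oh, 'ah, 'x, 'y) bimap
    \<Rightarrow> ('og, 'ag, 'oh, 'ah, 'x, 'z) bimap" where
  "compose_bimap \<psi> \<phi> =
     \<lparr>bsrc = bsrc \<phi>, btrg = btrg \<psi>,
      bfun = compose (points (total (bsrc \<phi>))) (bfun \<psi>) (bfun \<phi>)\<rparr>"


section \<open>The balanced tensor product\<close>

definition balanced_pairs ::
  "('og, 'ag, 'oh, 'ah, 'x) bibundle \<Rightarrow> ('oh, 'ah, 'ok, 'ak, 'y) bibundle \<Rightarrow> ('x \<times> 'y) dspace" where
  "balanced_pairs X Y = fibre_product (total X) (rmom X) (lmom Y) (total Y)"

definition balanced_rel ::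
  "('og, 'ag, 'oh, 'ah, 'x) bibundle \<Rightarrow> ('oh, 'ah, 'ok, 'ak, 'y) bibundle
    \<Rightarrow> (('x \<times> 'y) \<times> ('x \<times> 'y)) set" where
  "balanced_rel X Y =
     {((x, y), (ract X (x, h), lact Y (ginv (rgrpd X) h, y))) | x y h.
        (x, y) \<in> points (balanced_pairs X Y) \<and>
        h \<in> points (arrs (rgrpd X)) \<and> rmom X x = gtrg (rgrpd X) h}"

definition tens ::
  "('og, 'ag, 'oh, 'ah, 'x) bibundle \<Rightarrow> ('oh, 'ah, 'ok, 'ak, 'y) bibundle
    \<Rightarrow> 'x \<Rightarrow> 'y \<Rightarrow> ('x \<times> 'y) set" where
  "tens X Y x y = balanced_rel X Y `` {(x, y)}"

text \<open>The value on a class \<open>C\<close> of the map induced by a function \<open>f\<close> that is constant on \<open>C\<close>.\<close>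

definition induced :: "('a \<Rightarrow> 'b) \<Rightarrow> 'a set \<Rightarrow> 'b" where
  "induced f C = the_elem (f ` C)"

definition tensor_space ::
  "('og, 'ag, 'oh, 'ah, 'x) bibundle \<Rightarrow> ('oh, 'ah, 'ok, 'ak, 'y) bibundle
    \<Rightarrow> ('x \<times> 'y) set dspace" where
  "tensor_space X Y = quotient_dspace (balanced_pairs X Y) (balanced_rel X Y)"

definition tensor_lmom ::
  "('og, 'ag, 'oh, 'ah, 'x) bibundle \<Rightarrow> ('oh, 'ah, 'ok, 'ak, 'y) bibundle
    \<Rightarrow> ('x \<times> 'y) set \<Rightarrow> 'og" where
  "tensor_lmom X Y = (\<lambda>C\<in>points (tensor_space X Y). induced (\<lambda>(x, y). lmom X x) C)"

definition tensor_rmom ::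
  "('og, 'ag, 'oh, 'ah, 'x) bibundle \<Rightarrow> ('oh, 'ah, 'ok, 'ak, 'y) bibundle
    \<Rightarrow> ('x \<times> 'y) set \<Rightarrow> 'ok" where
  "tensor_rmom X Y = (\<lambda>C\<in>points (tensor_space X Y). induced (\<lambda>(x, y). rmom Y y) C)"

definition tensor_bibundle ::
  "('og, 'ag, 'oh, 'ah, 'x) bibundle \<Rightarrow> ('oh, 'ah, 'ok, 'ak, 'y) bibundle
    \<Rightarrow> ('og, 'ag, 'ok, 'ak, ('x \<times> 'y) set) bibundle" where
  "tensor_bibundle X Y =
     \<lparr>lgrpd = lgrpd X, rgrpd = rgrpd Y, total = tensor_space X Y,
      lmom = tensor_lmom X Y, rmom = tensor_rmom X Y,
      lact = restrict (\<lambda>(g, C). induced (\<lambda>(x, y). tens X Y (lact X (g, x)) y) C)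
        (points (fibre_product (arrs (lgrpd X)) (gsrc (lgrpd X))
                   (tensor_lmom X Y) (tensor_space X Y))),
      ract = restrict (\<lambda>(C, k). induced (\<lambda>(x, y). tens X Y x (ract Y (y, k))) C)
        (points (fibre_product (tensor_space X Y) (tensor_rmom X Y)
                   (gtrg (rgrpd Y)) (arrs (rgrpd Y))))\<rparr>"

text \<open>\<open>\<phi> \<otimes> \<psi>\<close>, given by \<open>x \<otimes> y \<mapsto> \<phi> x \<otimes> \<psi> y\<close>.\<close>

definition tensor_bimap ::
  "('og, 'ag, 'oh, 'ah, 'x, 'x1) bimap \<Rightarrow> ('oh, 'ah, 'ok, 'ak, 'y, 'y1) bimap
    \<Rightarrow> ('og, 'ag, 'ok, 'ak, ('x \<times> 'y) set, ('x1 \<times> 'y1) set) bimap" where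
  "tensor_bimap \<phi> \<psi> =
     \<lparr>bsrc = tensor_bibundle (bsrc \<phi>) (bsrc \<psi>),
      btrg = tensor_bibundle (btrg \<phi>) (btrg \<psi>),
      bfun = (\<lambda>C\<in>points (tensor_space (bsrc \<phi>) (bsrc \<psi>)).
        induced (\<lambda>(x, y). tens (btrg \<phi>) (btrg \<psi>) (bfun \<phi> x) (bfun \<psi> y)) C)\<rparr>"


section \<open>Composition within a fixed universe\<close>

text \<open>
  HOL has no type of all sets, so the bicategory is formed over a universe: the subsets of an
  infinite type \<open>'u\<close>. The points of \<open>X \<otimes> Y\<close> are classes of pairs and hence do not have type \<open>'u\<close>;
  they are moved into \<open>'u\<close> along \<open>class_code\<close>, which is injective on disjoint nonempty classes if
  \<open>'u\<close> is infinite, and all structure is transported along this renaming of points.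
\<close>

definition pair_code :: "'u \<times> 'u \<Rightarrow> 'u" where
  "pair_code = (SOME c. inj c)"

definition class_code :: "('u \<times> 'u) set \<Rightarrow> 'u" where
  "class_code C = pair_code (SOME p. p \<in> C)"

lemma inj_pair_code:
  assumes "infinite (UNIV :: 'u set)"
  shows "inj (pair_code :: 'u \<times> 'u \<Rightarrow> 'u)"
proof -
  have "(card_of (UNIV \<times> UNIV :: ('u \<times> 'u) set), card_of (UNIV :: 'u set)) \<in> ordLeq"
    using card_of_Times_same_infinite[OF assms] ordIso_iff_ordLeq by blast
  then obtain c :: "'u \<times> 'u \<Rightarrow> 'u" where "inj c"
    unfolding card_of_ordLeq[symmetric] by auto
  then show ?thesis
    unfolding pair_code_def by (rule someI[of inj])
qed

lemma inj_on_class_code: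
  assumes "infinite (UNIV :: 'u set)" and "equiv A (R :: (('u \<times> 'u) \<times> ('u \<times> 'u)) set)"
  shows "inj_on class_code (A // R)"
proof (rule inj_onI)
  fix C D
  assume C: "C \<in> A // R" and D: "D \<in> A // R" and eq: "class_code C = class_code D"
  have "(SOME p. p \<in> C) = (SOME p. p \<in> D)"
    using eq inj_pair_code[OF assms(1)] unfolding class_code_def by (auto dest: injD)
  moreover have "(SOME p. p \<in> C) \<in> C" "(SOME p. p \<in> D) \<in> D"
    using in_quotient_imp_non_empty[OF assms(2) C] in_quotient_imp_non_empty[OF assms(2) D]
    by (simp_all add: some_in_eq)
  ultimately show "C = D"
    using quotient_disj[OF assms(2) C D] by auto
qed

definition rename_dspace :: "('x \<Rightarrow> 'y) \<Rightarrow> 'x dspace \<Rightarrow> 'y dspace" where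
  "rename_dspace c X =
     \<lparr>points = c ` points X,
      plots = \<lambda>m U. (\<lambda>\<alpha>. \<lambda>u\<in>U. c (\<alpha> u)) ` plots X m U\<rparr>"

definition rename_bibundle ::
  "('x \<Rightarrow> 'y) \<Rightarrow> ('og, 'ag, 'oh, 'ah, 'x) bibundle \<Rightarrow> ('og, 'ag, 'oh, 'ah, 'y) bibundle" where
  "rename_bibundle c X =
     (let T = rename_dspace c (total X);
          d = inv_into (points (total X)) c;
          l = (\<lambda>t\<in>points T. lmom X (d t));
          r = (\<lambda>t\<in>points T. rmom X (d t))
      in \<lparr>lgrpd = lgrpd X, rgrpd = rgrpd X, total = T, lmom = l, rmom = r,
          lact = restrict (\<lambda>(g, t). c (lact X (g, d t)))
            (points (fibre_product (arrs (lgrpd X)) (gsrc (lgrpd X)) l T)),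
          ract = restrict (\<lambda>(t, h). c (ract X (d t, h)))
            (points (fibre_product T r (gtrg (rgrpd X)) (arrs (rgrpd X))))\<rparr>)"

definition rename_bimap ::
  "('x \<Rightarrow> 'x1) \<Rightarrow> ('y \<Rightarrow> 'y1) \<Rightarrow> ('og, 'ag, 'oh, 'ah, 'x, 'y) bimap
    \<Rightarrow> ('og, 'ag, 'oh, 'ah, 'x1, 'y1) bimap" where
  "rename_bimap c c' \<phi> =
     \<lparr>bsrc = rename_bibundle c (bsrc \<phi>), btrg = rename_bibundle c' (btrg \<phi>),
      bfun = (\<lambda>t\<in>c ` points (total (bsrc \<phi>)).
        c' (bfun \<phi> (inv_into (points (total (bsrc \<phi>))) c t)))\<rparr>"

type_synonym 'u ugroupoid = "('u, 'u) dgroupoid"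
type_synonym 'u ubibundle = "('u, 'u, 'u, 'u, 'u) bibundle"
type_synonym 'u ubimap = "('u, 'u, 'u, 'u, 'u, 'u) bimap"

definition bibundle_comp :: "'u ubibundle \<Rightarrow> 'u ubibundle \<Rightarrow> 'u ubibundle" where
  "bibundle_comp X Y = rename_bibundle class_code (tensor_bibundle X Y)"

definition bimap_hcomp :: "'u ubimap \<Rightarrow> 'u ubimap \<Rightarrow> 'u ubimap" where
  "bimap_hcomp \<phi> \<psi> = rename_bimap class_code class_code (tensor_bimap \<phi> \<psi>)"


section \<open>Bicategories\<close>

text \<open>
  Composition of 1-cells and horizontal composition of 2-cells are written in diagrammatic order
  (\<open>f \<star> g\<close> for \<open>f : a \<rightarrow> b\<close> and \<open>g : b \<rightarrow> c\<close>), vertical composition in functional order (\<open>\<psi> \<cdot> \<phi>\<close> is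
  \<open>\<psi>\<close> after \<open>\<phi>\<close>). The operations are only constrained on composable arguments.
\<close>

locale bicategory_data =
  fixes Obj :: "'o set"
    and Mor :: "'m set"
    and dom cod :: "'m \<Rightarrow> 'o"
    and one :: "'o \<Rightarrow> 'm"
    and comp :: "'m \<Rightarrow> 'm \<Rightarrow> 'm"  (infixr "\<star>" 75)
    and Cell :: "'c set"
    and dom2 cod2 :: "'c \<Rightarrow> 'm"
    and one2 :: "'m \<Rightarrow> 'c"
    and vcomp :: "'c \<Rightarrow> 'c \<Rightarrow> 'c"  (infixr "\<cdot>" 65)
    and hcomp :: "'c \<Rightarrow> 'c \<Rightarrow> 'c"  (infixr "\<diamondop>" 75)
    and assoc :: "'m \<Rightarrow> 'm \<Rightarrow> 'm \<Rightarrow> 'c"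
    and lunit :: "'m \<Rightarrow> 'c"
    and runit :: "'m \<Rightarrow> 'c"
begin

definition cell :: "'c \<Rightarrow> 'm \<Rightarrow> 'm \<Rightarrow> bool" where
  "cell \<phi> f g \<longleftrightarrow> \<phi> \<in> Cell \<and> dom2 \<phi> = f \<and> cod2 \<phi> = g"

definition iso_cell :: "'c \<Rightarrow> 'm \<Rightarrow> 'm \<Rightarrow> bool" where
  "iso_cell \<phi> f g \<longleftrightarrow>
     cell \<phi> f g \<and> (\<exists>\<psi>. cell \<psi> g f \<and> \<psi> \<cdot> \<phi> = one2 f \<and> \<phi> \<cdot> \<psi> = one2 g)"

end

locale bicategory = bicategory_data +
  assumes
    \<comment> \<open>hom categories\<close>
    dom_cod: "f \<in> Mor \<Longrightarrow> dom f \<in> Obj \<and> cod f \<in> Obj"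
    and dom2_cod2:
      "\<phi> \<in> Cell \<Longrightarrow> dom2 \<phi> \<in> Mor \<and> cod2 \<phi> \<in> Mor \<and>
        dom (dom2 \<phi>) = dom (cod2 \<phi>) \<and> cod (dom2 \<phi>) = cod (cod2 \<phi>)"
    and one2: "f \<in> Mor \<Longrightarrow> cell (one2 f) f f"
    and vcomp: "cell \<phi> f g \<Longrightarrow> cell \<psi> g h \<Longrightarrow> cell (\<psi> \<cdot> \<phi>) f h"
    and vcomp_one2: "cell \<phi> f g \<Longrightarrow> \<phi> \<cdot> one2 f = \<phi>"
    and one2_vcomp: "cell \<phi> f g \<Longrightarrow> one2 g \<cdot> \<phi> = \<phi>"
    and vcomp_assoc:
      "cell \<phi> f g \<Longrightarrow> cell \<psi> g h \<Longrightarrow> cell \<theta> h k \<Longrightarrow> (\<theta> \<cdot> \<psi>) \<cdot> \<phi> = \<theta> \<cdot> (\<psi> \<cdot> \<phi>)"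
    \<comment> \<open>identities and composition functors\<close>
    and one: "a \<in> Obj \<Longrightarrow> one a \<in> Mor \<and> dom (one a) = a \<and> cod (one a) = a"
    and comp:
      "f \<in> Mor \<Longrightarrow> g \<in> Mor \<Longrightarrow> cod f = dom g
        \<Longrightarrow> f \<star> g \<in> Mor \<and> dom (f \<star> g) = dom f \<and> cod (f \<star> g) = cod g"
    and hcomp:
      "cell \<phi> f f' \<Longrightarrow> cell \<psi> g g' \<Longrightarrow> cod f = dom g \<Longrightarrow> cell (\<phi> \<diamondop> \<psi>) (f \<star> g) (f' \<star> g')"
    and hcomp_one2:
      "f \<in> Mor \<Longrightarrow> g \<in> Mor \<Longrightarrow> cod f = dom g \<Longrightarrow> one2 f \<diamondop> one2 g = one2 (f \<star> g)"
    and interchange: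
      "cell \<phi> f f' \<Longrightarrow> cell \<phi>' f' f'' \<Longrightarrow> cell \<psi> g g' \<Longrightarrow> cell \<psi>' g' g'' \<Longrightarrow> cod f = dom g
        \<Longrightarrow> (\<phi>' \<cdot> \<phi>) \<diamondop> (\<psi>' \<cdot> \<psi>) = (\<phi>' \<diamondop> \<psi>') \<cdot> (\<phi> \<diamondop> \<psi>)"
    \<comment> \<open>natural associativity and unit isomorphisms\<close>
    and assoc:
      "f \<in> Mor \<Longrightarrow> g \<in> Mor \<Longrightarrow> h \<in> Mor \<Longrightarrow> cod f = dom g \<Longrightarrow> cod g = dom h
        \<Longrightarrow> iso_cell (assoc f g h) ((f \<star> g) \<star> h) (f \<star> (g \<star> h))"
    and assoc_natural:
      "cell \<phi> f f' \<Longrightarrow> cell \<psi> g g' \<Longrightarrow> cell \<theta> h h' \<Longrightarrow> cod f = dom g \<Longrightarrow> cod g = dom h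
        \<Longrightarrow> assoc f' g' h' \<cdot> ((\<phi> \<diamondop> \<psi>) \<diamondop> \<theta>) = (\<phi> \<diamondop> (\<psi> \<diamondop> \<theta>)) \<cdot> assoc f g h"
    and lunit: "f \<in> Mor \<Longrightarrow> iso_cell (lunit f) (one (dom f) \<star> f) f"
    and lunit_natural:
      "cell \<phi> f f' \<Longrightarrow> lunit f' \<cdot> (one2 (one (dom f)) \<diamondop> \<phi>) = \<phi> \<cdot> lunit f"
    and runit: "f \<in> Mor \<Longrightarrow> iso_cell (runit f) (f \<star> one (cod f)) f"
    and runit_natural:
      "cell \<phi> f f' \<Longrightarrow> runit f' \<cdot> (\<phi> \<diamondop> one2 (one (cod f))) = \<phi> \<cdot> runit f"
    \<comment> \<open>coherence\<close>
    and pentagon: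
      "f \<in> Mor \<Longrightarrow> g \<in> Mor \<Longrightarrow> h \<in> Mor \<Longrightarrow> k \<in> Mor
        \<Longrightarrow> cod f = dom g \<Longrightarrow> cod g = dom h \<Longrightarrow> cod h = dom k
        \<Longrightarrow> assoc f g (h \<star> k) \<cdot> assoc (f \<star> g) h k =
            (one2 f \<diamondop> assoc g h k) \<cdot> assoc f (g \<star> h) k \<cdot> (assoc f g h \<diamondop> one2 k)"
    and triangle:
      "f \<in> Mor \<Longrightarrow> g \<in> Mor \<Longrightarrow> cod f = dom g
        \<Longrightarrow> (one2 f \<diamondop> lunit g) \<cdot> assoc f (one (cod f)) g = runit f \<diamondop> one2 g"

end

theory Submission
  imports Defs
begin

text \<open>
  A composite \<open>X \<odot> Y\<close> is a quotient by a relation that is simple to handle once its points are written as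
  \<open>x \<otimes> y\<close>. Two such points agree if and only if they differ by an arrow \<open>h\<close> of the middle groupoid that slides
  across the tensor sign, \<open>xh \<otimes> y = x \<otimes> hy\<close> (\<open>tensor_point_eq_iff\<close>). The moment maps and actions are given by
  the expected formulas on \<open>x \<otimes> y\<close> (\<open>comp_simps\<close>), and the plots are the functions that are locally \<open>\<xi> \<otimes> \<eta>\<close> for
  plots \<open>\<xi>\<close>, \<open>\<eta>\<close> with matching moments (\<open>comp_plotE\<close>, \<open>comp_plotI\<close>). Once these facts and
  the formula for the horizontal composite are available, neither equivalence classes nor their codes
  in the universe matter. They also show that \<open>X \<odot> Y\<close> is a bibundle:
  an action touches one factor only, and it commutes with the action by which the middle groupoid acts on
  that factor.

  A 2-cell on a composite is determined by its values on the points \<open>x \<otimes> y\<close>, and conversely a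
  formula on representatives gives a 2-cell if it respects the identifications and the structure and
  if plots lift locally to representatives (\<open>map_on_representatives\<close>). If these conditions hold in both
  directions, the 2-cell is invertible (\<open>iso_on_representatives\<close>). This applies as follows.

  \<^item> The horizontal composite is \<open>x \<otimes> y \<mapsto> \<phi>x \<otimes> \<psi>y\<close>.

  \<^item> The associator is \<open>(x \<otimes> y) \<otimes> z \<mapsto> x \<otimes> (y \<otimes> z)\<close> on triples. Both bracketings make the same
  identifications, namely those by one arrow between \<open>x\<close> and \<open>y\<close> and one between \<open>y\<close> and \<open>z\<close>.

  \<^item> The unitors are \<open>g \<otimes> x \<mapsto> gx\<close> and \<open>x \<otimes> h \<mapsto> xh\<close>. They are injective because sliding gives
  \<open>g \<otimes> x = id \<otimes> gx\<close> and \<open>x \<otimes> h = xh \<otimes> id\<close>, and their inverses \<open>x \<mapsto> id \<otimes> x\<close>, \<open>x \<mapsto> x \<otimes> id\<close> are smooth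
  because the unit maps and the moment maps are.

  All equations between 2-cells, that is, functoriality of the horizontal composition, naturality and
  coherence, are then checked on points. Using equivariance, both sides evaluate to the same expression; only
  for the triangle identity do they differ, by one slide.
\<close>

section \<open>Smooth maps between Euclidean domains\<close>

lemma Ck_on_mono:
  assumes "Ck_on k m U f" "V \<subseteq> U"
  shows "Ck_on k m V f"
  using assms(1)
proof (induction k arbitrary: f)
  case 0
  then show ?case
    using assms(2) by (auto intro: continuous_map_from_subtopology_mono)
next
  case (Suc k)
  then have "continuous_map (subtopology (Euclidean_space m) V) euclideanreal f"
    using assms(2) by (auto intro: continuous_map_from_subtopology_mono)
  moreover have "\<exists>f'. Ck_on k m V f' \<and>
      (\<forall>x\<in>V. ((\<lambda>t. f (x(i := t))) has_real_derivative f' x) (at (x i)))" if i: "i < m" for i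
  proof -
    obtain f' where f': "Ck_on k m U f'"
        "\<forall>x\<in>U. ((\<lambda>t. f (x(i := t))) has_real_derivative f' x) (at (x i))"
      using Suc.prems i unfolding Ck_on.simps by blast
    then show ?thesis
      using Suc.IH[OF f'(1)] assms(2) by blast
  qed
  ultimately show ?case
    by simp
qed

lemma Ck_on_const: "Ck_on k m U (\<lambda>_. c)"
proof (induction k arbitrary: c)
  case (Suc k)
  show ?case
    using Suc[of 0] by (auto intro!: exI[of _ "\<lambda>_. 0"])
qed simp

lemma continuous_map_Euclidean_space_component:
  "continuous_map (subtopology (Euclidean_space m) U) euclideanreal (\<lambda>v. v j)"
  unfolding Euclidean_space_def subtopology_subtopology
  by (intro continuous_map_from_subtopology continuous_map_product_projection) auto

lemma Ck_on_component: "Ck_on k m U (\<lambda>v. v j)"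
proof (cases k)
  case 0
  then show ?thesis
    by (simp add: continuous_map_Euclidean_space_component)
next
  case (Suc l)
  have "\<exists>f'. Ck_on l m U f' \<and>
      (\<forall>x\<in>U. ((\<lambda>t. (x(i := t)) j) has_real_derivative f' x) (at (x i)))" for i
    by (rule exI[of _ "\<lambda>_. if i = j then 1 else 0"])
       (auto simp: Ck_on_const intro!: derivative_eq_intros)
  then show ?thesis
    using Suc by (simp add: continuous_map_Euclidean_space_component)
qed

text \<open>
  Inclusions of domains are smooth, so that plots restrict to smaller domains.
\<close>

lemma smooth_euclidean_inclusion:
  assumes "W \<subseteq> U"
  shows "smooth_euclidean m W m U (\<lambda>v. v)"
  using assms by (auto simp: smooth_euclidean_def Ck_on_component)

lemma smooth_euclidean_mono:
  assumes "smooth_euclidean n V m U h" "V' \<subseteq> V" "h \<in> V' \<rightarrow> U'"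
  shows "smooth_euclidean n V' m U' h"
  using assms(1,3) Ck_on_mono[OF _ assms(2)] by (simp add: smooth_euclidean_def)

lemma continuous_map_smooth_euclidean:
  assumes "smooth_euclidean n V m U h" "openin (Euclidean_space m) U"
  shows "continuous_map (subtopology (Euclidean_space n) V) (Euclidean_space m) h"
proof -
  have U: "h v \<in> topspace (Euclidean_space m)" if "v \<in> V" for v
    using assms(1) openin_subset[OF assms(2)] that by (auto simp: smooth_euclidean_def Pi_iff)
  have "continuous_map (subtopology (Euclidean_space n) V) euclideanreal (\<lambda>v. h v j)" for j
  proof (cases "j < m")
    case True
    then have "Ck_on 0 n V (\<lambda>v. h v j)"
      using assms(1) unfolding smooth_euclidean_def by blast
    then show ?thesis by simp
  next
    case False
    have "continuous_map (subtopology (Euclidean_space n) V) euclideanreal (\<lambda>v. 0)"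
      by simp
    then show ?thesis
      by (rule continuous_map_eq) (use U False in \<open>auto simp: topspace_Euclidean_space\<close>)
  qed
  then show ?thesis
    unfolding Euclidean_space_def[of m] continuous_map_in_subtopology
    using U by (auto simp: continuous_map_componentwise_UNIV topspace_Euclidean_space)
qed

text \<open>
  If a plot lifts over \<open>W\<close>, its composite with \<open>h\<close> lifts over the preimage of \<open>W\<close>, which has to be a
  Euclidean domain again. Openness is where the continuity of smooth maps enters.
\<close>

lemma openin_smooth_euclidean_preimage:
  assumes h: "smooth_euclidean n V m U h"
    and V: "openin (Euclidean_space n) V" and U: "openin (Euclidean_space m) U"
    and W: "openin (Euclidean_space m) W"
  shows "openin (Euclidean_space n) {v \<in> V. h v \<in> W}"
proof -
  have "openin (subtopology (Euclidean_space n) V)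
      {v \<in> topspace (subtopology (Euclidean_space n) V). h v \<in> W}"
    using continuous_map_smooth_euclidean[OF h U] W by (rule openin_continuous_map_preimage)
  moreover have "topspace (subtopology (Euclidean_space n) V) = V"
    by (rule topspace_subtopology_subset) (rule openin_subset[OF V])
  ultimately show ?thesis
    using openin_open_subtopology[OF V] by (simp only:)
qed


section \<open>Plots\<close>

context diffeological_space
begin

lemma plot_open: "\<alpha> \<in> plots X m U \<Longrightarrow> openin (Euclidean_space m) U"
  and plot_extensional: "\<alpha> \<in> plots X m U \<Longrightarrow> \<alpha> \<in> extensional U"
  and plot_point: "\<alpha> \<in> plots X m U \<Longrightarrow> u \<in> U \<Longrightarrow> \<alpha> u \<in> points X"
  using plot_domain[of \<alpha> m U] by (auto simp: PiE_def)

lemma plot_restrict: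
  assumes "\<alpha> \<in> plots X m U" "openin (Euclidean_space m) W" "W \<subseteq> U"
  shows "restrict \<alpha> W \<in> plots X m W"
  using plot_compose[OF assms(1,2) smooth_euclidean_inclusion[OF assms(3)]]
  by (simp add: restrict_def)

text \<open>
  The locality axiom in a pointwise form. The covering family is taken to consist of all domains on
  which \<open>\<alpha>\<close> is already a plot; a given neighbourhood of each point suffices to see that they cover.
\<close>

lemma plot_if_locally_plot:
  assumes U: "openin (Euclidean_space m) U" and ext: "\<alpha> \<in> extensional U"
    and loc: "\<And>u. u \<in> U \<Longrightarrow> \<exists>W. openin (Euclidean_space m) W \<and> u \<in> W \<and> W \<subseteq> U \<and>
      (\<lambda>w\<in>W. \<alpha> w) \<in> plots X m W"
  shows "\<alpha> \<in> plots X m U"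
proof (rule plot_local[OF U, where \<W> =
      "{W. openin (Euclidean_space m) W \<and> W \<subseteq> U \<and> restrict \<alpha> W \<in> plots X m W}"])
  have "\<alpha> u \<in> points X" if "u \<in> U" for u
    using loc[OF that] plot_point by fastforce
  then show "\<alpha> \<in> U \<rightarrow>\<^sub>E points X"
    using ext by (auto simp: PiE_def)
qed (use loc in \<open>auto simp: restrict_def\<close>)

end

lemma smooth_in: "smooth X Y f \<Longrightarrow> x \<in> points X \<Longrightarrow> f x \<in> points Y"
  and smooth_extensional: "smooth X Y f \<Longrightarrow> f \<in> extensional (points X)"
  and smooth_plot: "smooth X Y f \<Longrightarrow> \<alpha> \<in> plots X m U \<Longrightarrow> (\<lambda>u\<in>U. f (\<alpha> u)) \<in> plots Y m U"
  by (auto simp: smooth_def PiE_def)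

lemma smooth_compose:
  assumes "diffeological_space X" "smooth X Y f" "smooth Y Z g"
  shows "smooth X Z (compose (points X) g f)"
proof -
  interpret diffeological_space X by fact
  have "(\<lambda>u\<in>U. compose (points X) g f (\<alpha> u)) \<in> plots Z m U" if \<alpha>: "\<alpha> \<in> plots X m U" for \<alpha> m U
  proof -
    have "(\<lambda>u\<in>U. compose (points X) g f (\<alpha> u)) = (\<lambda>u\<in>U. g ((\<lambda>u\<in>U. f (\<alpha> u)) u))"
      using plot_point[OF \<alpha>] by (auto simp: compose_def)
    then show ?thesis
      using smooth_plot[OF assms(3) smooth_plot[OF assms(2) \<alpha>]] by simp
  qed
  moreover have "compose (points X) g f \<in> points X \<rightarrow>\<^sub>E points Z"
    using assms(2,3) by (auto simp: compose_def dest: smooth_in)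
  ultimately show ?thesis
    by (simp add: smooth_def)
qed

lemma points_fibre_product [simp]:
  "points (fibre_product X f g Y) = {(x, y). x \<in> points X \<and> y \<in> points Y \<and> f x = g y}"
  by (simp add: fibre_product_def subset_dspace_def)

lemma plots_fibre_product:
  assumes "diffeological_space X" "diffeological_space Y"
  shows "\<gamma> \<in> plots (fibre_product X f g Y) m U \<longleftrightarrow>
    \<gamma> \<in> extensional U \<and> (\<lambda>u\<in>U. fst (\<gamma> u)) \<in> plots X m U \<and> (\<lambda>u\<in>U. snd (\<gamma> u)) \<in> plots Y m U \<and>
    (\<forall>u\<in>U. f (fst (\<gamma> u)) = g (snd (\<gamma> u)))"
proof -
  have "\<gamma> u \<in> points X \<times> points Y"
    if "(\<lambda>u\<in>U. fst (\<gamma> u)) \<in> plots X m U" "(\<lambda>u\<in>U. snd (\<gamma> u)) \<in> plots Y m U" "u \<in> U" for u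
    using diffeological_space.plot_point[OF assms(1) that(1,3)]
      diffeological_space.plot_point[OF assms(2) that(2,3)] that(3) by (simp add: mem_Times_iff)
  then show ?thesis
    by (auto simp: fibre_product_def subset_dspace_def product_dspace_def PiE_def Pi_iff
        mem_Times_iff image_subset_iff case_prod_beta)
qed

text \<open>
  A plot of a fibre product is a pair of plots with a common domain and matching values. Smoothness
  of an action is proved and used in this form.
\<close>

lemma smooth_fibre_productI:
  assumes "diffeological_space X" "diffeological_space Y"
    and "F \<in> points (fibre_product X f g Y) \<rightarrow>\<^sub>E points Z"
    and plot: "\<And>m U \<alpha> \<beta>. \<alpha> \<in> plots X m U \<Longrightarrow> \<beta> \<in> plots Y m U \<Longrightarrow> (\<And>u. u \<in> U \<Longrightarrow> f (\<alpha> u) = g (\<beta> u))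
      \<Longrightarrow> (\<lambda>u\<in>U. F (\<alpha> u, \<beta> u)) \<in> plots Z m U"
  shows "smooth (fibre_product X f g Y) Z F"
proof -
  have "(\<lambda>u\<in>U. F (\<gamma> u)) \<in> plots Z m U" if "\<gamma> \<in> plots (fibre_product X f g Y) m U" for \<gamma> m U
    using that[unfolded plots_fibre_product[OF assms(1,2)]]
      plot[of "\<lambda>u\<in>U. fst (\<gamma> u)" m U "\<lambda>u\<in>U. snd (\<gamma> u)"]
    by (simp cong: restrict_cong)
  then show ?thesis
    using assms(3) by (simp add: smooth_def)
qed

lemma smooth_fibre_product_plot:
  assumes "diffeological_space X" "diffeological_space Y"
    and "smooth (fibre_product X f g Y) Z F"
    and "\<alpha> \<in> plots X m U" "\<beta> \<in> plots Y m U" "\<And>u. u \<in> U \<Longrightarrow> f (\<alpha> u) = g (\<beta> u)"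
  shows "(\<lambda>u\<in>U. F (\<alpha> u, \<beta> u)) \<in> plots Z m U"
proof -
  have "(\<lambda>u\<in>U. \<alpha> u) = \<alpha>" "(\<lambda>u\<in>U. \<beta> u) = \<beta>"
    using diffeological_space.plot_extensional[OF assms(1,4)]
      diffeological_space.plot_extensional[OF assms(2,5)] by (simp_all add: extensional_restrict)
  then have "(\<lambda>u\<in>U. (\<alpha> u, \<beta> u)) \<in> plots (fibre_product X f g Y) m U"
    using assms by (simp add: plots_fibre_product cong: restrict_cong)
  from smooth_plot[OF assms(3) this] show ?thesis
    by (simp cong: restrict_cong)
qed


section \<open>Groupoids and bibundles\<close>

context diffeological_groupoid
begin

lemmas id_in = smooth_in[OF smooth_id]
  and inv_in = smooth_in[OF smooth_inv]
  and src_in = smooth_in[OF smooth_src]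
  and trg_in = smooth_in[OF smooth_trg]

lemma comp_in:
  assumes "g \<in> points (arrs G)" "h \<in> points (arrs G)" "gsrc G g = gtrg G h"
  shows "gcomp G (g, h) \<in> points (arrs G)"
  using smooth_in[OF smooth_comp] assms by simp

end

abbreviation pts :: "('og, 'ag, 'oh, 'ah, 'x) bibundle \<Rightarrow> 'x set" where
  "pts X \<equiv> points (total X)"

abbreviation larrs :: "('og, 'ag, 'oh, 'ah, 'x) bibundle \<Rightarrow> 'ag set" where
  "larrs X \<equiv> points (arrs (lgrpd X))"

abbreviation rarrs :: "('og, 'ag, 'oh, 'ah, 'x) bibundle \<Rightarrow> 'ah set" where
  "rarrs X \<equiv> points (arrs (rgrpd X))"

context diffeological_bibundle
begin

sublocale L: diffeological_groupoid "lgrpd X" by (rule lgrpd)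
sublocale R: diffeological_groupoid "rgrpd X" by (rule rgrpd)
sublocale T: diffeological_space "total X" by (rule total)
sublocale LA: smooth_left_action "lgrpd X" "total X" "lmom X" "lact X" by (rule left_action)
sublocale RA: smooth_right_action "rgrpd X" "total X" "rmom X" "ract X" by (rule right_action)

lemmas lmom_in = smooth_in[OF LA.smooth_moment]
  and rmom_in = smooth_in[OF RA.smooth_moment]

lemma lact_in:
  assumes "g \<in> larrs X" "x \<in> pts X" "gsrc (lgrpd X) g = lmom X x"
  shows "lact X (g, x) \<in> pts X"
  using smooth_in[OF LA.smooth_act] assms by simp

lemma ract_in:
  assumes "x \<in> pts X" "h \<in> rarrs X" "rmom X x = gtrg (rgrpd X) h"
  shows "ract X (x, h) \<in> pts X"
  using smooth_in[OF RA.smooth_act] assms by simp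

lemmas lact_plot = smooth_fibre_product_plot[OF L.arrs total LA.smooth_act]
  and ract_plot = smooth_fibre_product_plot[OF total R.arrs RA.smooth_act]

lemmas element_simps = lact_in ract_in LA.moment_act RA.moment_act lmom_ract rmom_lact

end


section \<open>Points of the balanced tensor product\<close>

text \<open>
  Writing \<open>y = hy'\<close> instead of \<open>y' = h\<inverse>y\<close> removes the inverse from the balancing relation. After
  this translation transitivity follows from the product \<open>hh'\<close>, and the inverse of a product is never
  computed.
\<close>

lemma
  fixes X :: "('og, 'ag, 'oh, 'ah, 'x) bibundle" and Y :: "('oh, 'ah, 'ok, 'ak, 'y) bibundle"
  assumes "diffeological_bibundle X" "diffeological_bibundle Y" and mid: "rgrpd X = lgrpd Y"
  shows balanced_rel_iff: "((x, y), (x', y')) \<in> balanced_rel X Y \<longleftrightarrow>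
      x \<in> pts X \<and> y' \<in> pts Y \<and>
      (\<exists>h\<in>larrs Y. rmom X x = gtrg (lgrpd Y) h \<and> gsrc (lgrpd Y) h = lmom Y y' \<and>
        x' = ract X (x, h) \<and> y = lact Y (h, y'))"
    and equiv_balanced_rel: "equiv (points (balanced_pairs X Y)) (balanced_rel X Y)"
proof -
  interpret X: diffeological_bibundle X by fact
  interpret Y: diffeological_bibundle Y by fact
  note [simp] = X.element_simps Y.element_simps mid Y.L.inv_in Y.L.src_inv Y.L.trg_inv Y.L.id_in
    Y.L.src_id Y.L.trg_id Y.L.src_in Y.L.trg_in Y.lmom_in
  have ract_id: "ract X (x, gid (lgrpd Y) (rmom X x)) = x" if "x \<in> pts X" for x
    using X.RA.act_id[OF that] by simp
  have ract_ract: "ract X (ract X (x, h), h') = ract X (x, gcomp (lgrpd Y) (h, h'))"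
    if "x \<in> pts X" "h \<in> larrs Y" "h' \<in> larrs Y" "rmom X x = gtrg (lgrpd Y) h"
      "gsrc (lgrpd Y) h = gtrg (lgrpd Y) h'" for x h h'
    using X.RA.act_act[of x h h'] that by simp
  have lact_inv: "lact Y (ginv (lgrpd Y) h, y) = y' \<longleftrightarrow> y = lact Y (h, y')"
    if "h \<in> larrs Y" "y \<in> pts Y" "y' \<in> pts Y" "gtrg (lgrpd Y) h = lmom Y y"
      "gsrc (lgrpd Y) h = lmom Y y'" for h y y'
    using that Y.LA.act_id[of y] Y.LA.act_id[of y']
      Y.LA.act_act[of "ginv (lgrpd Y) h" h y] Y.LA.act_act[of h "ginv (lgrpd Y) h" y']
      Y.L.inv_left[of h] Y.L.inv_right[of h] by auto
  have iff: "((x, y), (x', y')) \<in> balanced_rel X Y \<longleftrightarrow>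
      x \<in> pts X \<and> y' \<in> pts Y \<and>
      (\<exists>h\<in>larrs Y. rmom X x = gtrg (lgrpd Y) h \<and> gsrc (lgrpd Y) h = lmom Y y' \<and>
        x' = ract X (x, h) \<and> y = lact Y (h, y'))" (is "?L \<longleftrightarrow> ?R") for x y x' y'
  proof
    assume ?L
    then obtain h where h: "x \<in> pts X" "y \<in> pts Y" "rmom X x = lmom Y y" "h \<in> larrs Y"
      "rmom X x = gtrg (lgrpd Y) h" "x' = ract X (x, h)" "y' = lact Y (ginv (lgrpd Y) h, y)"
      by (auto simp: balanced_rel_def balanced_pairs_def)
    then show ?R
      using lact_inv[of h y y'] by (auto intro!: bexI[of _ h])
  next
    assume ?R
    then obtain h where h: "x \<in> pts X" "y' \<in> pts Y" "h \<in> larrs Y"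
      "rmom X x = gtrg (lgrpd Y) h" "gsrc (lgrpd Y) h = lmom Y y'"
      "x' = ract X (x, h)" "y = lact Y (h, y')"
      by auto
    then show ?L
      using lact_inv[of h y y'] by (auto simp: balanced_rel_def balanced_pairs_def)
  qed
  then show "((x, y), (x', y')) \<in> balanced_rel X Y \<longleftrightarrow>
      x \<in> pts X \<and> y' \<in> pts Y \<and>
      (\<exists>h\<in>larrs Y. rmom X x = gtrg (lgrpd Y) h \<and> gsrc (lgrpd Y) h = lmom Y y' \<and>
        x' = ract X (x, h) \<and> y = lact Y (h, y'))" .
  show "equiv (points (balanced_pairs X Y)) (balanced_rel X Y)"
  proof (rule equivI)
    show "balanced_rel X Y \<subseteq> points (balanced_pairs X Y) \<times> points (balanced_pairs X Y)"
      by (auto simp: iff balanced_pairs_def)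
    show "refl_on (points (balanced_pairs X Y)) (balanced_rel X Y)"
    proof (rule refl_onI)
      fix p assume "p \<in> points (balanced_pairs X Y)"
      then obtain x y where "p = (x, y)" "x \<in> pts X" "y \<in> pts Y" "rmom X x = lmom Y y"
        by (auto simp: balanced_pairs_def)
      then show "(p, p) \<in> balanced_rel X Y"
        using ract_id[of x] Y.LA.act_id[of y]
        by (auto simp: iff intro!: bexI[of _ "gid (lgrpd Y) (lmom Y y)"])
    qed
    show "sym (balanced_rel X Y)"
    proof (rule symI)
      fix p q assume "(p, q) \<in> balanced_rel X Y"
      moreover obtain x y x' y' where pq: "p = (x, y)" "q = (x', y')"
        by fastforce
      ultimately obtain h where h: "x \<in> pts X" "y' \<in> pts Y" "h \<in> larrs Y"
        "rmom X x = gtrg (lgrpd Y) h" "gsrc (lgrpd Y) h = lmom Y y'"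
        "x' = ract X (x, h)" "y = lact Y (h, y')"
        by (auto simp: iff)
      then have "ract X (x', ginv (lgrpd Y) h) = x" "lact Y (ginv (lgrpd Y) h, y) = y'"
        using ract_ract[of x h "ginv (lgrpd Y) h"] ract_id[of x] Y.L.inv_right[of h]
          lact_inv[of h y y'] by auto
      then show "(q, p) \<in> balanced_rel X Y"
        using h by (auto simp: pq iff intro!: bexI[of _ "ginv (lgrpd Y) h"])
    qed
    show "trans (balanced_rel X Y)"
    proof (rule transI)
      fix p q s assume "(p, q) \<in> balanced_rel X Y" "(q, s) \<in> balanced_rel X Y"
      moreover obtain x y x' y' x'' y'' where pqs: "p = (x, y)" "q = (x', y')" "s = (x'', y'')"
        by (metis prod.exhaust)
      ultimately obtain h h' where h: "x \<in> pts X" "y' \<in> pts Y" "h \<in> larrs Y"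
        "rmom X x = gtrg (lgrpd Y) h" "gsrc (lgrpd Y) h = lmom Y y'"
        "x' = ract X (x, h)" "y = lact Y (h, y')"
        and h': "x' \<in> pts X" "y'' \<in> pts Y" "h' \<in> larrs Y"
        "rmom X x' = gtrg (lgrpd Y) h'" "gsrc (lgrpd Y) h' = lmom Y y''"
        "x'' = ract X (x', h')" "y' = lact Y (h', y'')"
        by (auto simp: iff)
      then have "gsrc (lgrpd Y) h = gtrg (lgrpd Y) h'" by simp
      then show "(p, s) \<in> balanced_rel X Y"
        using h h' ract_ract[of x h h'] Y.LA.act_act[of h' h y'']
        by (auto simp: pqs iff Y.L.comp_in Y.L.src_comp Y.L.trg_comp
            intro!: bexI[of _ "gcomp (lgrpd Y) (h, h')"])
    qed
  qed
qed

text \<open>The class \<open>x \<otimes> y\<close>, moved into the universe.\<close>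

definition tensor_point :: "'u \<Rightarrow> 'u ubibundle \<Rightarrow> 'u ubibundle \<Rightarrow> 'u \<Rightarrow> 'u"
    ("(_ \<otimes>\<^bsub>_,_\<^esub> _)" [76, 0, 0, 76] 75) where
  "x \<otimes>\<^bsub>X,Y\<^esub> y = class_code (tens X Y x y)"

notation bibundle_comp (infixr "\<odot>" 77)

lemma lgrpd_bibundle_comp [simp]: "lgrpd (X \<odot> Y) = lgrpd X"
  and rgrpd_bibundle_comp [simp]: "rgrpd (X \<odot> Y) = rgrpd Y"
  by (simp_all add: bibundle_comp_def rename_bibundle_def tensor_bibundle_def Let_def)

locale composable_bibundles =
  X: diffeological_bibundle X + Y: diffeological_bibundle Y
  for X Y :: "'u ubibundle" +
  assumes infinite: "infinite (UNIV :: 'u set)"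
    and mid: "rgrpd X = lgrpd Y"
begin

lemmas balanced_rel_iff =
    balanced_rel_iff[OF X.diffeological_bibundle_axioms Y.diffeological_bibundle_axioms mid]
  and equiv_balanced_rel =
    equiv_balanced_rel[OF X.diffeological_bibundle_axioms Y.diffeological_bibundle_axioms mid]

lemma points_tensor_space:
  "points (tensor_space X Y) = points (balanced_pairs X Y) // balanced_rel X Y"
  by (simp add: tensor_space_def quotient_dspace_def)

lemma in_points_tensor_space:
  "C \<in> points (tensor_space X Y) \<longleftrightarrow>
    (\<exists>x\<in>pts X. \<exists>y\<in>pts Y. rmom X x = lmom Y y \<and> C = tens X Y x y)"
  by (auto simp: points_tensor_space quotient_def balanced_pairs_def tens_def)

lemma inj_on_class_code_tensor: "inj_on class_code (points (tensor_space X Y))"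
  unfolding points_tensor_space by (rule inj_on_class_code[OF infinite equiv_balanced_rel])

lemma inv_into_tensor_point:
  assumes "x \<in> pts X" "y \<in> pts Y" "rmom X x = lmom Y y"
  shows "inv_into (points (tensor_space X Y)) class_code (x \<otimes>\<^bsub>X,Y\<^esub> y) = tens X Y x y"
  unfolding tensor_point_def using assms
  by (intro inv_into_f_f[OF inj_on_class_code_tensor]) (auto simp: in_points_tensor_space)

lemma tensor_point_eq_iff:
  assumes "x \<in> pts X" "y \<in> pts Y" "rmom X x = lmom Y y"
    and "x' \<in> pts X" "y' \<in> pts Y" "rmom X x' = lmom Y y'"
  shows "x \<otimes>\<^bsub>X,Y\<^esub> y = x' \<otimes>\<^bsub>X,Y\<^esub> y' \<longleftrightarrow>
    (\<exists>h\<in>larrs Y. rmom X x = gtrg (lgrpd Y) h \<and> gsrc (lgrpd Y) h = lmom Y y' \<and>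
        x' = ract X (x, h) \<and> y = lact Y (h, y'))"
proof -
  have "x \<otimes>\<^bsub>X,Y\<^esub> y = x' \<otimes>\<^bsub>X,Y\<^esub> y' \<longleftrightarrow> tens X Y x y = tens X Y x' y'"
    by (metis inv_into_tensor_point assms tensor_point_def)
  also have "\<dots> \<longleftrightarrow> ((x, y), (x', y')) \<in> balanced_rel X Y"
    unfolding tens_def using assms
    by (intro eq_equiv_class_iff[OF equiv_balanced_rel]) (auto simp: balanced_pairs_def)
  finally show ?thesis
    using assms by (simp add: balanced_rel_iff)
qed

text \<open>
  The only relation among points of a composite: an arrow of the middle groupoid slides across the
  tensor sign.
\<close>

lemma tensor_point_slide:
  assumes "x \<in> pts X" "y \<in> pts Y" "h \<in> larrs Y"
    and "rmom X x = gtrg (lgrpd Y) h" "gsrc (lgrpd Y) h = lmom Y y"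
  shows "ract X (x, h) \<otimes>\<^bsub>X,Y\<^esub> y = x \<otimes>\<^bsub>X,Y\<^esub> lact Y (h, y)"
  using assms tensor_point_eq_iff[of x "lact Y (h, y)" "ract X (x, h)" y]
  by (auto simp: X.element_simps Y.element_simps mid)

text \<open>
  The function \<open>f\<close> is compared on the class of the given pair only. A condition on all pairs would be too
  strong for the left action \<open>(x, y) \<mapsto> gx \<otimes> y\<close> of a fixed \<open>g\<close>, because \<open>gx\<close> makes sense only if the source
  of \<open>g\<close> is the moment of \<open>x\<close>; the pairs of one class share that moment.
\<close>

lemma induced_tens:
  assumes xy: "x \<in> pts X" "y \<in> pts Y" "rmom X x = lmom Y y"
    and f: "\<And>h y'. h \<in> larrs Y \<Longrightarrow> y' \<in> pts Y \<Longrightarrow> rmom X x = gtrg (lgrpd Y) h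
      \<Longrightarrow> gsrc (lgrpd Y) h = lmom Y y' \<Longrightarrow> y = lact Y (h, y') \<Longrightarrow> f (ract X (x, h), y') = f (x, y)"
  shows "induced f (tens X Y x y) = f (x, y)"
proof -
  have "(x, y) \<in> tens X Y x y"
    using equiv_class_self[OF equiv_balanced_rel] xy by (auto simp: tens_def balanced_pairs_def)
  moreover have "f p = f (x, y)" if "p \<in> tens X Y x y" for p
    using that f by (cases p) (auto simp: tens_def balanced_rel_iff)
  ultimately have "f ` tens X Y x y = {f (x, y)}"
    by blast
  then show ?thesis
    by (simp add: induced_def)
qed

lemma tensor_lmom_tens:
  assumes "x \<in> pts X" "y \<in> pts Y" "rmom X x = lmom Y y"
  shows "tensor_lmom X Y (tens X Y x y) = lmom X x"
  using assms induced_tens[OF assms, of "\<lambda>(x, y). lmom X x"]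
  by (auto simp: tensor_lmom_def in_points_tensor_space X.lmom_ract mid)

lemma tensor_rmom_tens:
  assumes "x \<in> pts X" "y \<in> pts Y" "rmom X x = lmom Y y"
  shows "tensor_rmom X Y (tens X Y x y) = rmom Y y"
  using assms induced_tens[OF assms, of "\<lambda>(x, y). rmom Y y"]
  by (auto simp: tensor_rmom_def in_points_tensor_space Y.rmom_lact mid)

lemma tens_slide:
  assumes "x \<in> pts X" "y \<in> pts Y" "h \<in> larrs Y"
    and "rmom X x = gtrg (lgrpd Y) h" "gsrc (lgrpd Y) h = lmom Y y"
  shows "tens X Y (ract X (x, h)) y = tens X Y x (lact Y (h, y))"
  using tensor_point_slide[OF assms] inv_into_tensor_point[of "ract X (x, h)" y]
    inv_into_tensor_point[of x "lact Y (h, y)"] assms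
  by (simp add: X.element_simps Y.element_simps mid)

lemma total_comp: "total (X \<odot> Y) = rename_dspace class_code (tensor_space X Y)"
  by (simp add: bibundle_comp_def rename_bibundle_def tensor_bibundle_def Let_def)

lemma in_pts_comp:
  "p \<in> pts (X \<odot> Y) \<longleftrightarrow> (\<exists>x\<in>pts X. \<exists>y\<in>pts Y. rmom X x = lmom Y y \<and> p = x \<otimes>\<^bsub>X,Y\<^esub> y)"
  by (auto simp: total_comp rename_dspace_def in_points_tensor_space tensor_point_def image_iff Bex_def)

lemma tensor_point_in [simp]:
  "x \<in> pts X \<Longrightarrow> y \<in> pts Y \<Longrightarrow> rmom X x = lmom Y y \<Longrightarrow> x \<otimes>\<^bsub>X,Y\<^esub> y \<in> pts (X \<odot> Y)"
  by (auto simp: in_pts_comp)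

lemma lmom_comp_eq: "lmom (X \<odot> Y) = (\<lambda>p\<in>pts (X \<odot> Y).
    tensor_lmom X Y (inv_into (points (tensor_space X Y)) class_code p))"
  and rmom_comp_eq: "rmom (X \<odot> Y) = (\<lambda>p\<in>pts (X \<odot> Y).
    tensor_rmom X Y (inv_into (points (tensor_space X Y)) class_code p))"
  by (simp_all add: bibundle_comp_def rename_bibundle_def tensor_bibundle_def Let_def)

lemma lmom_comp:
  assumes "x \<in> pts X" "y \<in> pts Y" "rmom X x = lmom Y y"
  shows "lmom (X \<odot> Y) (x \<otimes>\<^bsub>X,Y\<^esub> y) = lmom X x"
  using assms by (simp add: lmom_comp_eq inv_into_tensor_point tensor_lmom_tens)

lemma rmom_comp:
  assumes "x \<in> pts X" "y \<in> pts Y" "rmom X x = lmom Y y"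
  shows "rmom (X \<odot> Y) (x \<otimes>\<^bsub>X,Y\<^esub> y) = rmom Y y"
  using assms by (simp add: rmom_comp_eq inv_into_tensor_point tensor_rmom_tens)

lemma lact_comp_extensional: "lact (X \<odot> Y) \<in> extensional
    {(g, p). g \<in> larrs X \<and> p \<in> pts (X \<odot> Y) \<and> gsrc (lgrpd X) g = lmom (X \<odot> Y) p}"
  and ract_comp_extensional: "ract (X \<odot> Y) \<in> extensional
    {(p, h). p \<in> pts (X \<odot> Y) \<and> h \<in> rarrs Y \<and> rmom (X \<odot> Y) p = gtrg (rgrpd Y) h}"
  by (simp_all add: bibundle_comp_def rename_bibundle_def tensor_bibundle_def Let_def)

text \<open>
  Acting on the first factor respects the balancing relation because the two actions on \<open>X\<close> commute:
  \<open>g(xh) \<otimes> y = (gx)h \<otimes> y = gx \<otimes> hy\<close>.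
\<close>

lemma lact_comp:
  assumes xy: "x \<in> pts X" "y \<in> pts Y" "rmom X x = lmom Y y"
    and g: "g \<in> larrs X" "gsrc (lgrpd X) g = lmom X x"
  shows "lact (X \<odot> Y) (g, x \<otimes>\<^bsub>X,Y\<^esub> y) = lact X (g, x) \<otimes>\<^bsub>X,Y\<^esub> y"
proof -
  have "lact (X \<odot> Y) (g, x \<otimes>\<^bsub>X,Y\<^esub> y) = class_code (lact (tensor_bibundle X Y)
      (g, inv_into (points (tensor_space X Y)) class_code (x \<otimes>\<^bsub>X,Y\<^esub> y)))"
    using assms lmom_comp[OF xy] tensor_point_in[OF xy]
    by (simp add: bibundle_comp_def rename_bibundle_def Let_def)
       (simp add: tensor_bibundle_def)
  also have "\<dots> = class_code (lact (tensor_bibundle X Y) (g, tens X Y x y))"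
    by (simp add: inv_into_tensor_point xy)
  also have "lact (tensor_bibundle X Y) (g, tens X Y x y) =
      induced (\<lambda>(x, y). tens X Y (lact X (g, x)) y) (tens X Y x y)"
    using assms by (auto simp: tensor_bibundle_def tensor_lmom_tens in_points_tensor_space)
  also have "\<dots> = tens X Y (lact X (g, x)) y"
    using assms by (subst induced_tens)
      (auto simp: X.element_simps tens_slide[symmetric] X.lact_ract mid)
  finally show ?thesis
    by (simp add: tensor_point_def)
qed

lemma ract_comp:
  assumes xy: "x \<in> pts X" "y \<in> pts Y" "rmom X x = lmom Y y"
    and k: "k \<in> rarrs Y" "rmom Y y = gtrg (rgrpd Y) k"
  shows "ract (X \<odot> Y) (x \<otimes>\<^bsub>X,Y\<^esub> y, k) = x \<otimes>\<^bsub>X,Y\<^esub> ract Y (y, k)"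
proof -
  have "ract (X \<odot> Y) (x \<otimes>\<^bsub>X,Y\<^esub> y, k) = class_code (ract (tensor_bibundle X Y)
      (inv_into (points (tensor_space X Y)) class_code (x \<otimes>\<^bsub>X,Y\<^esub> y), k))"
    using assms rmom_comp[OF xy] tensor_point_in[OF xy]
    by (simp add: bibundle_comp_def rename_bibundle_def Let_def)
       (simp add: tensor_bibundle_def)
  also have "\<dots> = class_code (ract (tensor_bibundle X Y) (tens X Y x y, k))"
    by (simp add: inv_into_tensor_point xy)
  also have "ract (tensor_bibundle X Y) (tens X Y x y, k) =
      induced (\<lambda>(x, y). tens X Y x (ract Y (y, k))) (tens X Y x y)"
    using assms by (auto simp: tensor_bibundle_def tensor_rmom_tens in_points_tensor_space)
  also have "\<dots> = tens X Y x (ract Y (y, k))"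
    using assms by (subst induced_tens)
      (auto simp: Y.element_simps tens_slide Y.lact_ract mid)
  finally show ?thesis
    by (simp add: tensor_point_def)
qed

end


section \<open>The balanced tensor product is a bibundle\<close>

context composable_bibundles
begin

lemma plots_tensor_space: "plots (tensor_space X Y) m U =
    {\<alpha> \<in> U \<rightarrow>\<^sub>E points (tensor_space X Y). openin (Euclidean_space m) U \<and>
      (\<forall>u\<in>U. \<exists>W. openin (Euclidean_space m) W \<and> u \<in> W \<and> W \<subseteq> U \<and>
        (\<exists>\<beta>\<in>plots (balanced_pairs X Y) m W. \<forall>w\<in>W. \<alpha> w = balanced_rel X Y `` {\<beta> w}))}"
  by (simp add: tensor_space_def quotient_dspace_def)

text \<open>
  Lifting to the quotient and then splitting the lift into its components shows that the plots of the
  composite are the functions which are locally of the form \<open>\<xi> \<otimes> \<eta>\<close> for plots \<open>\<xi>\<close> of \<open>X\<close> and \<open>\<eta>\<close> of \<open>Y\<close>.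
\<close>

lemma comp_plotE:
  assumes "\<alpha> \<in> plots (total (X \<odot> Y)) m U" "u \<in> U"
  obtains W \<xi> \<eta> where "openin (Euclidean_space m) W" "u \<in> W" "W \<subseteq> U"
    and "\<xi> \<in> plots (total X) m W" "\<eta> \<in> plots (total Y) m W"
    and "\<And>w. w \<in> W \<Longrightarrow> rmom X (\<xi> w) = lmom Y (\<eta> w)"
    and "\<And>w. w \<in> W \<Longrightarrow> \<alpha> w = \<xi> w \<otimes>\<^bsub>X,Y\<^esub> \<eta> w"
proof -
  obtain \<alpha>' where \<alpha>': "\<alpha>' \<in> plots (tensor_space X Y) m U" "\<alpha> = (\<lambda>u\<in>U. class_code (\<alpha>' u))"
    using assms(1) by (auto simp: total_comp rename_dspace_def)
  obtain W \<beta> where W: "openin (Euclidean_space m) W" "u \<in> W" "W \<subseteq> U"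
    and \<beta>: "\<beta> \<in> plots (balanced_pairs X Y) m W" "\<forall>w\<in>W. \<alpha>' w = balanced_rel X Y `` {\<beta> w}"
    using \<alpha>'(1) assms(2) unfolding plots_tensor_space mem_Collect_eq by (elim conjE) (drule (1) bspec, elim exE conjE bexE, rule that)
  have \<beta>': "(\<lambda>w\<in>W. fst (\<beta> w)) \<in> plots (total X) m W" "(\<lambda>w\<in>W. snd (\<beta> w)) \<in> plots (total Y) m W"
    "\<forall>w\<in>W. rmom X (fst (\<beta> w)) = lmom Y (snd (\<beta> w))"
    using \<beta>(1) unfolding balanced_pairs_def plots_fibre_product[OF X.total Y.total] by auto
  show thesis
  proof (rule that[OF W \<beta>'(1,2)])
    fix w assume w: "w \<in> W"
    then show "rmom X ((\<lambda>w\<in>W. fst (\<beta> w)) w) = lmom Y ((\<lambda>w\<in>W. snd (\<beta> w)) w)"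
      using \<beta>'(3) by simp
    have "\<alpha> w = class_code (balanced_rel X Y `` {\<beta> w})"
      using w W(3) \<beta>(2) by (simp add: \<alpha>'(2) subset_iff)
    then show "\<alpha> w = (\<lambda>w\<in>W. fst (\<beta> w)) w \<otimes>\<^bsub>X,Y\<^esub> (\<lambda>w\<in>W. snd (\<beta> w)) w"
      using w by (simp add: tensor_point_def tens_def)
  qed
qed

lemma comp_plot_open: "\<alpha> \<in> plots (total (X \<odot> Y)) m U \<Longrightarrow> openin (Euclidean_space m) U"
  and comp_plot_funcset: "\<alpha> \<in> plots (total (X \<odot> Y)) m U \<Longrightarrow> \<alpha> \<in> U \<rightarrow>\<^sub>E pts (X \<odot> Y)"
  by (auto simp: total_comp rename_dspace_def tensor_space_def quotient_dspace_def)

lemma comp_plotI: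
  assumes U: "openin (Euclidean_space m) U" and ext: "\<alpha> \<in> extensional U"
    and loc: "\<And>u. u \<in> U \<Longrightarrow> \<exists>W \<xi> \<eta>. openin (Euclidean_space m) W \<and> u \<in> W \<and> W \<subseteq> U \<and>
      \<xi> \<in> plots (total X) m W \<and> \<eta> \<in> plots (total Y) m W \<and>
      (\<forall>w\<in>W. rmom X (\<xi> w) = lmom Y (\<eta> w) \<and> \<alpha> w = \<xi> w \<otimes>\<^bsub>X,Y\<^esub> \<eta> w)"
  shows "\<alpha> \<in> plots (total (X \<odot> Y)) m U"
proof -
  define d where "d = inv_into (points (tensor_space X Y)) class_code"
  define \<alpha>' where "\<alpha>' = (\<lambda>u\<in>U. d (\<alpha> u))"
  have lift: "\<exists>W. openin (Euclidean_space m) W \<and> u \<in> W \<and> W \<subseteq> U \<and>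
      (\<exists>\<beta>\<in>plots (balanced_pairs X Y) m W. \<forall>w\<in>W. \<alpha>' w = balanced_rel X Y `` {\<beta> w}) \<and>
      (\<forall>w\<in>W. \<alpha>' w \<in> points (tensor_space X Y) \<and> class_code (\<alpha>' w) = \<alpha> w)"
    if u: "u \<in> U" for u
  proof -
    obtain W \<xi> \<eta> where W: "openin (Euclidean_space m) W" "u \<in> W" "W \<subseteq> U"
      and plot: "\<xi> \<in> plots (total X) m W" "\<eta> \<in> plots (total Y) m W"
      and eq: "\<And>w. w \<in> W \<Longrightarrow> rmom X (\<xi> w) = lmom Y (\<eta> w)" "\<And>w. w \<in> W \<Longrightarrow> \<alpha> w = \<xi> w \<otimes>\<^bsub>X,Y\<^esub> \<eta> w"
      using loc[OF u] by blast
    have "\<xi> w \<in> pts X" "\<eta> w \<in> pts Y" "\<alpha>' w = tens X Y (\<xi> w) (\<eta> w)" if "w \<in> W" for w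
      using X.T.plot_point[OF plot(1)] Y.T.plot_point[OF plot(2)] that W(3) eq[OF that]
      by (auto simp: \<alpha>'_def d_def inv_into_tensor_point)
    moreover have "(\<lambda>w\<in>W. (\<xi> w, \<eta> w)) \<in> plots (balanced_pairs X Y) m W"
    proof -
      have "(\<lambda>w\<in>W. \<xi> w) = \<xi>" "(\<lambda>w\<in>W. \<eta> w) = \<eta>"
        using X.T.plot_extensional[OF plot(1)] Y.T.plot_extensional[OF plot(2)]
        by (simp_all add: extensional_restrict)
      then show ?thesis
        unfolding balanced_pairs_def plots_fibre_product[OF X.total Y.total]
        using plot eq(1) by (simp cong: restrict_cong)
    qed
    ultimately show ?thesis
      using W eq by (intro exI[of _ W] conjI bexI[of _ "\<lambda>w\<in>W. (\<xi> w, \<eta> w)"])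
        (auto simp: tens_def[symmetric] in_points_tensor_space tensor_point_def, blast)
  qed
  have "\<alpha>' \<in> plots (tensor_space X Y) m U"
    unfolding plots_tensor_space
  proof (intro CollectI conjI ballI U)
    show "\<alpha>' \<in> U \<rightarrow>\<^sub>E points (tensor_space X Y)"
    proof (rule PiE_I)
      show "\<alpha>' u \<in> points (tensor_space X Y)" if "u \<in> U" for u
        using lift[OF that] by blast
    qed (simp add: \<alpha>'_def)
    show "\<exists>W. openin (Euclidean_space m) W \<and> u \<in> W \<and> W \<subseteq> U \<and>
        (\<exists>\<beta>\<in>plots (balanced_pairs X Y) m W. \<forall>w\<in>W. \<alpha>' w = balanced_rel X Y `` {\<beta> w})"
      if "u \<in> U" for u
      using lift[OF that] by (elim exE conjE, intro exI conjI)
  qed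
  moreover have "\<alpha> = (\<lambda>u\<in>U. class_code (\<alpha>' u))"
  proof (rule extensionalityI[OF ext restrict_extensional])
    fix u assume "u \<in> U"
    then show "\<alpha> u = (\<lambda>u\<in>U. class_code (\<alpha>' u)) u"
      using lift[of u] by auto
  qed
  ultimately show ?thesis
    by (auto simp: total_comp rename_dspace_def)
qed

lemma tensor_point_plot:
  assumes "\<xi> \<in> plots (total X) m U" "\<eta> \<in> plots (total Y) m U"
    and "\<And>u. u \<in> U \<Longrightarrow> rmom X (\<xi> u) = lmom Y (\<eta> u)"
  shows "(\<lambda>u\<in>U. \<xi> u \<otimes>\<^bsub>X,Y\<^esub> \<eta> u) \<in> plots (total (X \<odot> Y)) m U"
proof (rule comp_plotI)
  fix u assume u: "u \<in> U"
  show "\<exists>W \<xi>' \<eta>'. openin (Euclidean_space m) W \<and> u \<in> W \<and> W \<subseteq> U \<and>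
      \<xi>' \<in> plots (total X) m W \<and> \<eta>' \<in> plots (total Y) m W \<and>
      (\<forall>w\<in>W. rmom X (\<xi>' w) = lmom Y (\<eta>' w) \<and>
        (\<lambda>u\<in>U. \<xi> u \<otimes>\<^bsub>X,Y\<^esub> \<eta> u) w = \<xi>' w \<otimes>\<^bsub>X,Y\<^esub> \<eta>' w)"
    by (rule exI[of _ U], rule exI[of _ \<xi>], rule exI[of _ \<eta>])
       (use assms u X.T.plot_open in auto)
qed (use assms(1) X.T.plot_open in auto)

text \<open>
  Smoothness of a map defined on a composite may be tested on plots \<open>\<xi> \<otimes> \<eta>\<close>. The map \<open>F\<close> may depend on the
  parameter as well; this covers actions, where a plot of arrows varies along with \<open>\<alpha>\<close>.
\<close>

lemma plot_if_plot_on_tensor_points: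
  assumes Z: "diffeological_space Z" and \<alpha>: "\<alpha> \<in> plots (total (X \<odot> Y)) m U"
    and F: "\<And>W \<xi> \<eta>. openin (Euclidean_space m) W \<Longrightarrow> W \<subseteq> U
      \<Longrightarrow> \<xi> \<in> plots (total X) m W \<Longrightarrow> \<eta> \<in> plots (total Y) m W
      \<Longrightarrow> (\<And>w. w \<in> W \<Longrightarrow> rmom X (\<xi> w) = lmom Y (\<eta> w))
      \<Longrightarrow> (\<And>w. w \<in> W \<Longrightarrow> \<alpha> w = \<xi> w \<otimes>\<^bsub>X,Y\<^esub> \<eta> w)
      \<Longrightarrow> (\<lambda>w\<in>W. F w (\<xi> w \<otimes>\<^bsub>X,Y\<^esub> \<eta> w)) \<in> plots Z m W"
  shows "(\<lambda>u\<in>U. F u (\<alpha> u)) \<in> plots Z m U"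
proof (rule diffeological_space.plot_if_locally_plot[OF Z comp_plot_open[OF \<alpha>]])
  fix u assume u: "u \<in> U"
  obtain W \<xi> \<eta> where W: "openin (Euclidean_space m) W" "u \<in> W" "W \<subseteq> U"
    and plot: "\<xi> \<in> plots (total X) m W" "\<eta> \<in> plots (total Y) m W"
    and eq: "\<And>w. w \<in> W \<Longrightarrow> rmom X (\<xi> w) = lmom Y (\<eta> w)" "\<And>w. w \<in> W \<Longrightarrow> \<alpha> w = \<xi> w \<otimes>\<^bsub>X,Y\<^esub> \<eta> w"
    by (rule comp_plotE[OF \<alpha> u]) (rule that)
  have "(\<lambda>w\<in>W. F w (\<xi> w \<otimes>\<^bsub>X,Y\<^esub> \<eta> w)) = (\<lambda>w\<in>W. (\<lambda>u\<in>U. F u (\<alpha> u)) w)"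
    using W(3) eq(2) by (intro restrict_ext) auto
  then show "\<exists>W. openin (Euclidean_space m) W \<and> u \<in> W \<and> W \<subseteq> U \<and>
      (\<lambda>w\<in>W. (\<lambda>u\<in>U. F u (\<alpha> u)) w) \<in> plots Z m W"
    using W F[OF W(1,3) plot eq] by (intro exI[of _ W]) simp
qed simp

lemma diffeological_space_comp: "diffeological_space (total (X \<odot> Y))"
proof (rule diffeological_space.intro)
  fix \<alpha> m U assume \<alpha>: "\<alpha> \<in> plots (total (X \<odot> Y)) m U"
  show "openin (Euclidean_space m) U \<and> \<alpha> \<in> U \<rightarrow>\<^sub>E pts (X \<odot> Y)"
    by (rule conjI[OF comp_plot_open[OF \<alpha>] comp_plot_funcset[OF \<alpha>]])
next
  fix m U p assume U: "openin (Euclidean_space m) U" and "p \<in> pts (X \<odot> Y)"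
  then obtain x y where xy: "x \<in> pts X" "y \<in> pts Y" "rmom X x = lmom Y y" "p = x \<otimes>\<^bsub>X,Y\<^esub> y"
    by (auto simp: in_pts_comp)
  have "(\<lambda>u\<in>U. (\<lambda>u\<in>U. x) u \<otimes>\<^bsub>X,Y\<^esub> (\<lambda>u\<in>U. y) u) \<in> plots (total (X \<odot> Y)) m U"
    using xy by (intro tensor_point_plot X.T.plot_const[OF U] Y.T.plot_const[OF U]) auto
  then show "(\<lambda>u\<in>U. p) \<in> plots (total (X \<odot> Y)) m U"
    by (simp add: xy cong: restrict_cong)
next
  fix \<alpha> m U n V h
  assume \<alpha>: "\<alpha> \<in> plots (total (X \<odot> Y)) m U" and V: "openin (Euclidean_space n) V"
    and h: "smooth_euclidean n V m U h"
  show "(\<lambda>v\<in>V. \<alpha> (h v)) \<in> plots (total (X \<odot> Y)) n V"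
  proof (rule comp_plotI[OF V])
    fix v assume v: "v \<in> V"
    then have hv: "h v \<in> U"
      using h by (auto simp: smooth_euclidean_def)
    obtain W \<xi> \<eta> where W: "openin (Euclidean_space m) W" "h v \<in> W" "W \<subseteq> U"
      and plot: "\<xi> \<in> plots (total X) m W" "\<eta> \<in> plots (total Y) m W"
      and eq: "\<And>w. w \<in> W \<Longrightarrow> rmom X (\<xi> w) = lmom Y (\<eta> w)" "\<And>w. w \<in> W \<Longrightarrow> \<alpha> w = \<xi> w \<otimes>\<^bsub>X,Y\<^esub> \<eta> w"
      by (rule comp_plotE[OF \<alpha> hv]) (rule that)
    define V' where "V' = {v \<in> V. h v \<in> W}"
    have V': "openin (Euclidean_space n) V'"
      unfolding V'_def by (rule openin_smooth_euclidean_preimage[OF h V comp_plot_open[OF \<alpha>] W(1)])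
    have h': "smooth_euclidean n V' m W h"
      by (rule smooth_euclidean_mono[OF h]) (auto simp: V'_def)
    show "\<exists>V' \<xi>' \<eta>'. openin (Euclidean_space n) V' \<and> v \<in> V' \<and> V' \<subseteq> V \<and>
        \<xi>' \<in> plots (total X) n V' \<and> \<eta>' \<in> plots (total Y) n V' \<and>
        (\<forall>v\<in>V'. rmom X (\<xi>' v) = lmom Y (\<eta>' v) \<and> (\<lambda>v\<in>V. \<alpha> (h v)) v = \<xi>' v \<otimes>\<^bsub>X,Y\<^esub> \<eta>' v)"
      using V' v W(2) eq X.T.plot_compose[OF plot(1) V' h'] Y.T.plot_compose[OF plot(2) V' h']
      by (intro exI[of _ V'] exI[of _ "\<lambda>v\<in>V'. \<xi> (h v)"] exI[of _ "\<lambda>v\<in>V'. \<eta> (h v)"])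
         (auto simp: V'_def)
  qed simp
next
  fix \<alpha> m U \<W>
  assume U: "openin (Euclidean_space m) U" and \<alpha>: "\<alpha> \<in> U \<rightarrow>\<^sub>E pts (X \<odot> Y)" and cover: "\<Union>\<W> = U"
    and loc: "\<And>W. W \<in> \<W> \<Longrightarrow> openin (Euclidean_space m) W \<and>
      restrict \<alpha> W \<in> plots (total (X \<odot> Y)) m W"
  show "\<alpha> \<in> plots (total (X \<odot> Y)) m U"
  proof (rule comp_plotI[OF U])
    show "\<alpha> \<in> extensional U"
      using \<alpha> by (simp add: PiE_def)
    fix u assume "u \<in> U"
    then obtain W where W: "W \<in> \<W>" "u \<in> W"
      using cover by blast
    obtain W' \<xi> \<eta> where W': "openin (Euclidean_space m) W'" "u \<in> W'" "W' \<subseteq> W"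
      and plot: "\<xi> \<in> plots (total X) m W'" "\<eta> \<in> plots (total Y) m W'"
      and eq: "\<And>w. w \<in> W' \<Longrightarrow> rmom X (\<xi> w) = lmom Y (\<eta> w)"
        "\<And>w. w \<in> W' \<Longrightarrow> restrict \<alpha> W w = \<xi> w \<otimes>\<^bsub>X,Y\<^esub> \<eta> w"
      by (rule comp_plotE[OF conjunct2[OF loc[OF W(1)]] W(2)]) (rule that)
    have "\<alpha> w = \<xi> w \<otimes>\<^bsub>X,Y\<^esub> \<eta> w" if "w \<in> W'" for w
      using eq(2)[OF that] that W'(3) by auto
    then show "\<exists>W \<xi> \<eta>. openin (Euclidean_space m) W \<and> u \<in> W \<and> W \<subseteq> U \<and>
        \<xi> \<in> plots (total X) m W \<and> \<eta> \<in> plots (total Y) m W \<and>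
        (\<forall>w\<in>W. rmom X (\<xi> w) = lmom Y (\<eta> w) \<and> \<alpha> w = \<xi> w \<otimes>\<^bsub>X,Y\<^esub> \<eta> w)"
      using W W' plot eq(1) cover by blast
  qed
qed

lemmas comp_simps = lmom_comp rmom_comp lact_comp ract_comp

lemma pts_compE:
  assumes "p \<in> pts (X \<odot> Y)"
  obtains x y where "x \<in> pts X" "y \<in> pts Y" "rmom X x = lmom Y y" "p = x \<otimes>\<^bsub>X,Y\<^esub> y"
  using assms by (auto simp: in_pts_comp)

text \<open>
  Along a plot \<open>\<xi> \<otimes> \<eta>\<close> the left action only changes \<open>\<xi>\<close>, and the result \<open>\<gamma>\<xi> \<otimes> \<eta>\<close> is again of this form by
  smoothness of the action on \<open>X\<close>.
\<close>

lemma smooth_left_action_comp: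
  "smooth_left_action (lgrpd X) (total (X \<odot> Y)) (lmom (X \<odot> Y)) (lact (X \<odot> Y))"
proof (rule smooth_left_action.intro)
  note [simp] = X.element_simps Y.element_simps mid comp_simps X.lmom_in
  show "smooth (total (X \<odot> Y)) (obs (lgrpd X)) (lmom (X \<odot> Y))"
    unfolding smooth_def
  proof (intro conjI allI ballI)
    show "lmom (X \<odot> Y) \<in> pts (X \<odot> Y) \<rightarrow>\<^sub>E points (obs (lgrpd X))"
    proof (rule PiE_I)
      fix p assume "p \<in> pts (X \<odot> Y)"
      then show "lmom (X \<odot> Y) p \<in> points (obs (lgrpd X))"
        by (auto simp: in_pts_comp)
    qed (simp add: lmom_comp_eq)
    fix m U \<alpha> assume \<alpha>: "\<alpha> \<in> plots (total (X \<odot> Y)) m U"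
    show "(\<lambda>u\<in>U. lmom (X \<odot> Y) (\<alpha> u)) \<in> plots (obs (lgrpd X)) m U"
    proof (rule plot_if_plot_on_tensor_points[OF X.L.obs \<alpha>])
      fix W \<xi> \<eta>
      assume plot: "\<xi> \<in> plots (total X) m W" "\<eta> \<in> plots (total Y) m W"
        and eq: "\<And>w. w \<in> W \<Longrightarrow> rmom X (\<xi> w) = lmom Y (\<eta> w)"
      have "(\<lambda>w\<in>W. lmom (X \<odot> Y) (\<xi> w \<otimes>\<^bsub>X,Y\<^esub> \<eta> w)) = (\<lambda>w\<in>W. lmom X (\<xi> w))"
        using X.T.plot_point[OF plot(1)] Y.T.plot_point[OF plot(2)] eq by (intro restrict_ext) simp
      then show "(\<lambda>w\<in>W. lmom (X \<odot> Y) (\<xi> w \<otimes>\<^bsub>X,Y\<^esub> \<eta> w)) \<in> plots (obs (lgrpd X)) m W"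
        using smooth_plot[OF X.LA.smooth_moment plot(1)] by simp
    qed
  qed
  show "smooth (fibre_product (arrs (lgrpd X)) (gsrc (lgrpd X)) (lmom (X \<odot> Y)) (total (X \<odot> Y)))
      (total (X \<odot> Y)) (lact (X \<odot> Y))"
  proof (rule smooth_fibre_productI[OF X.L.arrs diffeological_space_comp])
    show "lact (X \<odot> Y) \<in> points (fibre_product (arrs (lgrpd X)) (gsrc (lgrpd X))
        (lmom (X \<odot> Y)) (total (X \<odot> Y))) \<rightarrow>\<^sub>E pts (X \<odot> Y)"
      using lact_comp_extensional by (auto simp: PiE_def elim!: pts_compE)
    fix m U \<gamma> \<alpha>
    assume \<gamma>: "\<gamma> \<in> plots (arrs (lgrpd X)) m U" and \<alpha>: "\<alpha> \<in> plots (total (X \<odot> Y)) m U"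
      and src: "\<And>u. u \<in> U \<Longrightarrow> gsrc (lgrpd X) (\<gamma> u) = lmom (X \<odot> Y) (\<alpha> u)"
    interpret A: diffeological_space "arrs (lgrpd X)" by (rule X.L.arrs)
    show "(\<lambda>u\<in>U. lact (X \<odot> Y) (\<gamma> u, \<alpha> u)) \<in> plots (total (X \<odot> Y)) m U"
    proof (rule plot_if_plot_on_tensor_points[OF diffeological_space_comp \<alpha>])
      fix W \<xi> \<eta>
      assume W: "openin (Euclidean_space m) W" "W \<subseteq> U"
        and plot: "\<xi> \<in> plots (total X) m W" "\<eta> \<in> plots (total Y) m W"
        and eq: "\<And>w. w \<in> W \<Longrightarrow> rmom X (\<xi> w) = lmom Y (\<eta> w)"
          "\<And>w. w \<in> W \<Longrightarrow> \<alpha> w = \<xi> w \<otimes>\<^bsub>X,Y\<^esub> \<eta> w"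
      have pt: "\<xi> w \<in> pts X" "\<eta> w \<in> pts Y" "\<gamma> w \<in> larrs X" "gsrc (lgrpd X) (\<gamma> w) = lmom X (\<xi> w)"
        if "w \<in> W" for w
        using that X.T.plot_point[OF plot(1)] Y.T.plot_point[OF plot(2)] eq[OF that] W(2) src[of w]
          A.plot_point[OF \<gamma>, of w] by auto
      have "(\<lambda>w\<in>W. lact X (restrict \<gamma> W w, \<xi> w)) \<in> plots (total X) m W"
        by (rule X.lact_plot[OF A.plot_restrict[OF \<gamma> W] plot(1)]) (simp add: pt)
      from tensor_point_plot[OF this plot(2)] have
        "(\<lambda>w\<in>W. lact X (\<gamma> w, \<xi> w) \<otimes>\<^bsub>X,Y\<^esub> \<eta> w) \<in> plots (total (X \<odot> Y)) m W"
        using pt eq by (simp cong: restrict_cong)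
      then show "(\<lambda>w\<in>W. lact (X \<odot> Y) (\<gamma> w, \<xi> w \<otimes>\<^bsub>X,Y\<^esub> \<eta> w)) \<in> plots (total (X \<odot> Y)) m W"
        using pt eq by (simp cong: restrict_cong)
    qed
  qed
qed (auto simp: in_pts_comp comp_simps X.element_simps X.LA.act_id X.LA.act_act X.L.comp_in
      X.L.src_comp X.L.trg_comp X.L.id_in X.L.src_id X.lmom_in)

lemma smooth_right_action_comp:
  "smooth_right_action (rgrpd Y) (total (X \<odot> Y)) (rmom (X \<odot> Y)) (ract (X \<odot> Y))"
proof (rule smooth_right_action.intro)
  note [simp] = X.element_simps Y.element_simps mid comp_simps Y.rmom_in
  show "smooth (total (X \<odot> Y)) (obs (rgrpd Y)) (rmom (X \<odot> Y))"
    unfolding smooth_def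
  proof (intro conjI allI ballI)
    show "rmom (X \<odot> Y) \<in> pts (X \<odot> Y) \<rightarrow>\<^sub>E points (obs (rgrpd Y))"
    proof (rule PiE_I)
      fix p assume "p \<in> pts (X \<odot> Y)"
      then show "rmom (X \<odot> Y) p \<in> points (obs (rgrpd Y))"
        by (auto simp: in_pts_comp)
    qed (simp add: rmom_comp_eq)
    fix m U \<alpha> assume \<alpha>: "\<alpha> \<in> plots (total (X \<odot> Y)) m U"
    show "(\<lambda>u\<in>U. rmom (X \<odot> Y) (\<alpha> u)) \<in> plots (obs (rgrpd Y)) m U"
    proof (rule plot_if_plot_on_tensor_points[OF Y.R.obs \<alpha>])
      fix W \<xi> \<eta>
      assume plot: "\<xi> \<in> plots (total X) m W" "\<eta> \<in> plots (total Y) m W"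
        and eq: "\<And>w. w \<in> W \<Longrightarrow> rmom X (\<xi> w) = lmom Y (\<eta> w)"
      have "(\<lambda>w\<in>W. rmom (X \<odot> Y) (\<xi> w \<otimes>\<^bsub>X,Y\<^esub> \<eta> w)) = (\<lambda>w\<in>W. rmom Y (\<eta> w))"
        using X.T.plot_point[OF plot(1)] Y.T.plot_point[OF plot(2)] eq by (intro restrict_ext) simp
      then show "(\<lambda>w\<in>W. rmom (X \<odot> Y) (\<xi> w \<otimes>\<^bsub>X,Y\<^esub> \<eta> w)) \<in> plots (obs (rgrpd Y)) m W"
        using smooth_plot[OF Y.RA.smooth_moment plot(2)] by simp
    qed
  qed
  show "smooth (fibre_product (total (X \<odot> Y)) (rmom (X \<odot> Y)) (gtrg (rgrpd Y)) (arrs (rgrpd Y)))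
      (total (X \<odot> Y)) (ract (X \<odot> Y))"
  proof (rule smooth_fibre_productI[OF diffeological_space_comp Y.R.arrs])
    show "ract (X \<odot> Y) \<in> points (fibre_product (total (X \<odot> Y)) (rmom (X \<odot> Y))
        (gtrg (rgrpd Y)) (arrs (rgrpd Y))) \<rightarrow>\<^sub>E pts (X \<odot> Y)"
      using ract_comp_extensional by (auto simp: PiE_def elim!: pts_compE)
    fix m U \<gamma> \<alpha>
    assume \<alpha>: "\<alpha> \<in> plots (total (X \<odot> Y)) m U" and \<gamma>: "\<gamma> \<in> plots (arrs (rgrpd Y)) m U"
      and trg: "\<And>u. u \<in> U \<Longrightarrow> rmom (X \<odot> Y) (\<alpha> u) = gtrg (rgrpd Y) (\<gamma> u)"
    interpret A: diffeological_space "arrs (rgrpd Y)" by (rule Y.R.arrs)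
    show "(\<lambda>u\<in>U. ract (X \<odot> Y) (\<alpha> u, \<gamma> u)) \<in> plots (total (X \<odot> Y)) m U"
    proof (rule plot_if_plot_on_tensor_points[OF diffeological_space_comp \<alpha>])
      fix W \<xi> \<eta>
      assume W: "openin (Euclidean_space m) W" "W \<subseteq> U"
        and plot: "\<xi> \<in> plots (total X) m W" "\<eta> \<in> plots (total Y) m W"
        and eq: "\<And>w. w \<in> W \<Longrightarrow> rmom X (\<xi> w) = lmom Y (\<eta> w)"
          "\<And>w. w \<in> W \<Longrightarrow> \<alpha> w = \<xi> w \<otimes>\<^bsub>X,Y\<^esub> \<eta> w"
      have pt: "\<xi> w \<in> pts X" "\<eta> w \<in> pts Y" "\<gamma> w \<in> rarrs Y" "rmom Y (\<eta> w) = gtrg (rgrpd Y) (\<gamma> w)"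
        if "w \<in> W" for w
        using that X.T.plot_point[OF plot(1)] Y.T.plot_point[OF plot(2)] eq[OF that] W(2) trg[of w]
          A.plot_point[OF \<gamma>, of w] by auto
      have "(\<lambda>w\<in>W. ract Y (\<eta> w, restrict \<gamma> W w)) \<in> plots (total Y) m W"
        by (rule Y.ract_plot[OF plot(2) A.plot_restrict[OF \<gamma> W]]) (simp add: pt)
      from tensor_point_plot[OF plot(1) this] have
        "(\<lambda>w\<in>W. \<xi> w \<otimes>\<^bsub>X,Y\<^esub> ract Y (\<eta> w, \<gamma> w)) \<in> plots (total (X \<odot> Y)) m W"
        using pt eq by (simp cong: restrict_cong)
      then show "(\<lambda>w\<in>W. ract (X \<odot> Y) (\<xi> w \<otimes>\<^bsub>X,Y\<^esub> \<eta> w, \<gamma> w)) \<in> plots (total (X \<odot> Y)) m W"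
        using pt eq by (simp cong: restrict_cong)
    qed
  qed
qed (auto simp: in_pts_comp comp_simps Y.element_simps Y.RA.act_id Y.RA.act_act Y.R.comp_in
      Y.R.src_comp Y.R.trg_comp Y.R.id_in Y.R.trg_id Y.rmom_in)

lemma diffeological_bibundle_comp: "diffeological_bibundle (X \<odot> Y)"
  by (rule diffeological_bibundle.intro)
    (auto simp: in_pts_comp comp_simps X.element_simps Y.element_simps X.lgrpd Y.rgrpd
   diffeological_space_comp smooth_left_action_comp smooth_right_action_comp)

end


section \<open>Biequivariant maps given on representatives\<close>

text \<open>
  The underlying functions are extensional, so 2-cells between the same bibundles may be compared
  pointwise.
\<close>

lemma bimap_eqI:
  assumes "biequivariant_smooth_map \<phi>" "biequivariant_smooth_map \<psi>"
    and "bsrc \<phi> = bsrc \<psi>" "btrg \<phi> = btrg \<psi>"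
    and "\<And>x. x \<in> pts (bsrc \<psi>) \<Longrightarrow> bfun \<phi> x = bfun \<psi> x"
  shows "\<phi> = \<psi>"
proof -
  have "bfun \<phi> = bfun \<psi>"
    using assms smooth_extensional[OF biequivariant_smooth_map.smooth_bfun[OF assms(1)]]
      smooth_extensional[OF biequivariant_smooth_map.smooth_bfun[OF assms(2)]]
    by (intro extensionalityI[of _ "pts (bsrc \<psi>)"]) auto
  then show ?thesis
    using assms(3,4) by simp
qed

context biequivariant_smooth_map
begin

sublocale src: diffeological_bibundle "bsrc \<phi>" by (rule bsrc)
sublocale trg: diffeological_bibundle "btrg \<phi>" by (rule btrg)

lemmas bfun_in = smooth_in[OF smooth_bfun]
  and bfun_plot = smooth_plot[OF smooth_bfun]

end

text \<open>
  Horizontal composites, associators and unitors are given by formulas on representatives: the points of \<open>P\<close> are written as \<open>p t\<close> for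
  some \<open>t\<close> in a set \<open>T\<close>, and the map sends \<open>p t\<close> to \<open>q t\<close>. The assumptions say when such a prescription gives
  a biequivariant smooth map. The one on plots asks for a local lift \<open>\<tau>\<close> to representatives along which \<open>q\<close>
  yields a plot; \<open>T\<close> itself carries no diffeology.

  The actions are treated by representatives too: \<open>t'\<close> stands for the result of acting on \<open>t\<close>. Since \<open>p\<close> and
  \<open>q\<close> enter symmetrically, an isomorphism arises from a pair \<open>p\<close>, \<open>q\<close> that satisfies the assumptions in both
  orders.
\<close>

locale map_on_representatives =
  P: diffeological_bibundle P + Q: diffeological_bibundle Q
  for P :: "('og, 'ag, 'oh, 'ah, 'x) bibundle" and Q :: "('og, 'ag, 'oh, 'ah, 'y) bibundle" +
  fixes T :: "'t set" and p :: "'t \<Rightarrow> 'x" and q :: "'t \<Rightarrow> 'y"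
  assumes same_lgrpd: "lgrpd P = lgrpd Q" and same_rgrpd: "rgrpd P = rgrpd Q"
    and surj: "s \<in> pts P \<Longrightarrow> \<exists>t\<in>T. s = p t"
    and well_defined: "t \<in> T \<Longrightarrow> t' \<in> T \<Longrightarrow> p t = p t' \<Longrightarrow> q t = q t'"
    and q_in: "t \<in> T \<Longrightarrow> q t \<in> pts Q"
    and lmom_rep: "t \<in> T \<Longrightarrow> lmom P (p t) = lmom Q (q t)"
    and rmom_rep: "t \<in> T \<Longrightarrow> rmom P (p t) = rmom Q (q t)"
    and lact_rep: "t \<in> T \<Longrightarrow> g \<in> larrs Q \<Longrightarrow> gsrc (lgrpd Q) g = lmom Q (q t) \<Longrightarrow>
      \<exists>t'\<in>T. p t' = lact P (g, p t) \<and> q t' = lact Q (g, q t)"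
    and ract_rep: "t \<in> T \<Longrightarrow> h \<in> rarrs Q \<Longrightarrow> rmom Q (q t) = gtrg (rgrpd Q) h \<Longrightarrow>
      \<exists>t'\<in>T. p t' = ract P (p t, h) \<and> q t' = ract Q (q t, h)"
    and plot_rep: "\<alpha> \<in> plots (total P) m U \<Longrightarrow> u \<in> U \<Longrightarrow>
      \<exists>W \<tau>. openin (Euclidean_space m) W \<and> u \<in> W \<and> W \<subseteq> U \<and>
        (\<forall>w\<in>W. \<tau> w \<in> T \<and> \<alpha> w = p (\<tau> w)) \<and> (\<lambda>w\<in>W. q (\<tau> w)) \<in> plots (total Q) m W"
begin

lemma biequivariant_if_agrees:
  assumes \<phi>: "bsrc \<phi> = P" "btrg \<phi> = Q" "bfun \<phi> \<in> extensional (pts P)"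
    and eq: "\<And>t. t \<in> T \<Longrightarrow> bfun \<phi> (p t) = q t"
  shows "biequivariant_smooth_map \<phi>"
proof (rule biequivariant_smooth_map.intro)
  show "smooth (total (bsrc \<phi>)) (total (btrg \<phi>)) (bfun \<phi>)"
    unfolding smooth_def \<phi>
  proof (intro conjI allI ballI)
    show "bfun \<phi> \<in> pts P \<rightarrow>\<^sub>E pts Q"
    proof (rule PiE_I)
      fix s assume "s \<in> pts P"
      with surj obtain t where "t \<in> T" "s = p t" by blast
      then show "bfun \<phi> s \<in> pts Q"
        by (simp add: eq q_in)
    qed (use \<phi>(3) in \<open>simp add: extensional_def\<close>)
    fix m U \<alpha> assume \<alpha>: "\<alpha> \<in> plots (total P) m U"
    show "(\<lambda>u\<in>U. bfun \<phi> (\<alpha> u)) \<in> plots (total Q) m U"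
    proof (rule Q.T.plot_if_locally_plot[OF P.T.plot_open[OF \<alpha>]])
      fix u assume u: "u \<in> U"
      obtain W \<tau> where W: "openin (Euclidean_space m) W" "u \<in> W" "W \<subseteq> U"
        and \<tau>: "\<forall>w\<in>W. \<tau> w \<in> T \<and> \<alpha> w = p (\<tau> w)" "(\<lambda>w\<in>W. q (\<tau> w)) \<in> plots (total Q) m W"
        using plot_rep[OF \<alpha> u] by blast
      have "(\<lambda>w\<in>W. (\<lambda>u\<in>U. bfun \<phi> (\<alpha> u)) w) = (\<lambda>w\<in>W. q (\<tau> w))"
        using W(3) \<tau>(1) eq by (intro restrict_ext) auto
      then show "\<exists>W. openin (Euclidean_space m) W \<and> u \<in> W \<and> W \<subseteq> U \<and>
          (\<lambda>w\<in>W. (\<lambda>u\<in>U. bfun \<phi> (\<alpha> u)) w) \<in> plots (total Q) m W"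
        using W \<tau>(2) by (intro exI[of _ W]) simp
    qed simp
  qed
next
  fix g s assume g: "g \<in> larrs (bsrc \<phi>)" "s \<in> pts (bsrc \<phi>)" "gsrc (lgrpd (bsrc \<phi>)) g = lmom (bsrc \<phi>) s"
  then obtain t where "t \<in> T" "s = p t"
    using surj \<phi> by auto
  moreover from this obtain t' where "t' \<in> T" "p t' = lact P (g, p t)" "q t' = lact Q (g, q t)"
    using g lact_rep[of t g] lmom_rep \<phi> same_lgrpd by auto
  ultimately show "bfun \<phi> (lact (bsrc \<phi>) (g, s)) = lact (btrg \<phi>) (g, bfun \<phi> s)"
    using eq \<phi> by metis
next
  fix h s assume h: "s \<in> pts (bsrc \<phi>)" "h \<in> rarrs (bsrc \<phi>)" "rmom (bsrc \<phi>) s = gtrg (rgrpd (bsrc \<phi>)) h"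
  then obtain t where "t \<in> T" "s = p t"
    using surj \<phi> by auto
  moreover from this obtain t' where "t' \<in> T" "p t' = ract P (p t, h)" "q t' = ract Q (q t, h)"
    using h ract_rep[of t h] rmom_rep \<phi> same_rgrpd by auto
  ultimately show "bfun \<phi> (ract (bsrc \<phi>) (s, h)) = ract (btrg \<phi>) (bfun \<phi> s, h)"
    using eq \<phi> by metis
next
  fix s assume "s \<in> pts (bsrc \<phi>)"
  then obtain t where "t \<in> T" "s = p t"
    using surj \<phi> by auto
  then show "lmom (btrg \<phi>) (bfun \<phi> s) = lmom (bsrc \<phi>) s"
    and "rmom (btrg \<phi>) (bfun \<phi> s) = rmom (bsrc \<phi>) s"
    using lmom_rep rmom_rep by (simp_all add: \<phi> eq)
next
  show "diffeological_bibundle (bsrc \<phi>)" "diffeological_bibundle (btrg \<phi>)"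
    unfolding \<phi> by (rule P.diffeological_bibundle_axioms, rule Q.diffeological_bibundle_axioms)
qed (simp_all only: \<phi> same_lgrpd same_rgrpd)

end

definition map_by_representatives ::
  "('og, 'ag, 'oh, 'ah, 'x) bibundle \<Rightarrow> ('og, 'ag, 'oh, 'ah, 'y) bibundle \<Rightarrow>
    't set \<Rightarrow> ('t \<Rightarrow> 'x) \<Rightarrow> ('t \<Rightarrow> 'y) \<Rightarrow> ('og, 'ag, 'oh, 'ah, 'x, 'y) bimap" where
  "map_by_representatives P Q T p q =
     \<lparr>bsrc = P, btrg = Q, bfun = (\<lambda>s\<in>pts P. q (SOME t. t \<in> T \<and> p t = s))\<rparr>"

lemma bsrc_map_by_representatives [simp]: "bsrc (map_by_representatives P Q T p q) = P"
  and btrg_map_by_representatives [simp]: "btrg (map_by_representatives P Q T p q) = Q"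
  by (simp_all add: map_by_representatives_def)

lemma (in map_on_representatives) bfun_map_by_representatives:
  assumes "t \<in> T" "p t \<in> pts P"
  shows "bfun (map_by_representatives P Q T p q) (p t) = q t"
proof -
  have "(SOME t'. t' \<in> T \<and> p t' = p t) \<in> T \<and> p (SOME t'. t' \<in> T \<and> p t' = p t) = p t"
    using someI_ex[of "\<lambda>t'. t' \<in> T \<and> p t' = p t"] assms(1) by blast
  then have "q (SOME t'. t' \<in> T \<and> p t' = p t) = q t"
    by (intro well_defined[OF _ assms(1)]) simp_all
  then show ?thesis
    using assms(2) by (simp add: map_by_representatives_def)
qed

locale iso_on_representatives =
  map_on_representatives P Q T p q + inverse: map_on_representatives Q P T q p
  for P :: "('og, 'ag, 'oh, 'ah, 'x) bibundle" and Q :: "('og, 'ag, 'oh, 'ah, 'y) bibundle"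
    and T :: "'t set" and p :: "'t \<Rightarrow> 'x" and q :: "'t \<Rightarrow> 'y"
begin

abbreviation fwd where "fwd \<equiv> map_by_representatives P Q T p q"
abbreviation bwd where "bwd \<equiv> map_by_representatives Q P T q p"

lemma fwd_rep: "t \<in> T \<Longrightarrow> bfun fwd (p t) = q t"
  by (simp add: bfun_map_by_representatives inverse.q_in)

lemma bwd_rep: "t \<in> T \<Longrightarrow> bfun bwd (q t) = p t"
  by (simp add: inverse.bfun_map_by_representatives q_in)

lemma biequivariant_fwd: "biequivariant_smooth_map fwd"
  by (rule biequivariant_if_agrees) (simp_all add: fwd_rep, simp add: map_by_representatives_def)

lemma biequivariant_bwd: "biequivariant_smooth_map bwd"
  by (rule inverse.biequivariant_if_agrees) (simp_all add: bwd_rep, simp add: map_by_representatives_def)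

lemma bwd_fwd: "compose_bimap bwd fwd = identity_bimap P"
proof -
  have "compose (pts P) (bfun bwd) (bfun fwd) = (\<lambda>x\<in>pts P. x)"
  proof (rule extensionalityI[of _ "pts P"])
    fix s assume "s \<in> pts P"
    with surj obtain t where "t \<in> T" "s = p t" by blast
    then show "compose (pts P) (bfun bwd) (bfun fwd) s = (\<lambda>x\<in>pts P. x) s"
      by (simp add: compose_def fwd_rep bwd_rep inverse.q_in)
  qed (simp_all add: compose_def)
  then show ?thesis
    by (simp add: compose_bimap_def identity_bimap_def)
qed

lemma fwd_bwd: "compose_bimap fwd bwd = identity_bimap Q"
proof -
  have "compose (pts Q) (bfun fwd) (bfun bwd) = (\<lambda>x\<in>pts Q. x)"
  proof (rule extensionalityI[of _ "pts Q"])
    fix s assume "s \<in> pts Q"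
    with inverse.surj obtain t where "t \<in> T" "s = q t" by blast
    then show "compose (pts Q) (bfun fwd) (bfun bwd) s = (\<lambda>x\<in>pts Q. x) s"
      by (simp add: compose_def fwd_rep bwd_rep q_in)
  qed (simp_all add: compose_def)
  then show ?thesis
    by (simp add: compose_bimap_def identity_bimap_def)
qed

end


section \<open>Vertical and horizontal composition of biequivariant maps\<close>

lemma biequivariant_identity_bimap:
  assumes "diffeological_bibundle X"
  shows "biequivariant_smooth_map (identity_bimap X)"
proof -
  interpret diffeological_bibundle X by fact
  have "(\<lambda>u\<in>U. if \<alpha> u \<in> pts X then \<alpha> u else undefined) \<in> plots (total X) m U"
    if \<alpha>: "\<alpha> \<in> plots (total X) m U" for \<alpha> m U
  proof -
    have "(\<lambda>u\<in>U. if \<alpha> u \<in> pts X then \<alpha> u else undefined) = \<alpha>"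
      using T.plot_point[OF \<alpha>] T.plot_extensional[OF \<alpha>]
      by (intro extensionalityI[of _ U]) auto
    then show ?thesis
      using \<alpha> by simp
  qed
  then have "smooth (total X) (total X) (\<lambda>x\<in>pts X. x)"
    by (auto simp: smooth_def restrict_def)
  then show ?thesis
    using assms by (intro biequivariant_smooth_map.intro) (simp_all add: identity_bimap_def lact_in ract_in)
qed

lemma bfun_identity_bimap [simp]: "x \<in> pts X \<Longrightarrow> bfun (identity_bimap X) x = x"
  and bsrc_identity_bimap [simp]: "bsrc (identity_bimap X) = X"
  and btrg_identity_bimap [simp]: "btrg (identity_bimap X) = X"
  by (simp_all add: identity_bimap_def)

lemma bfun_compose_bimap [simp]:
    "x \<in> pts (bsrc \<phi>) \<Longrightarrow> bfun (compose_bimap \<psi> \<phi>) x = bfun \<psi> (bfun \<phi> x)"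
  and bsrc_compose_bimap [simp]: "bsrc (compose_bimap \<psi> \<phi>) = bsrc \<phi>"
  and btrg_compose_bimap [simp]: "btrg (compose_bimap \<psi> \<phi>) = btrg \<psi>"
  by (simp_all add: compose_bimap_def compose_def)

lemma biequivariant_compose_bimap:
  assumes "biequivariant_smooth_map \<phi>" "biequivariant_smooth_map \<psi>" "btrg \<phi> = bsrc \<psi>"
  shows "biequivariant_smooth_map (compose_bimap \<psi> \<phi>)"
proof -
  interpret \<phi>: biequivariant_smooth_map \<phi> by fact
  interpret \<psi>: biequivariant_smooth_map \<psi> by fact
  have smooth: "smooth (total (bsrc \<phi>)) (total (btrg \<psi>)) (bfun (compose_bimap \<psi> \<phi>))"
    using smooth_compose[OF \<phi>.src.total \<phi>.smooth_bfun] \<psi>.smooth_bfun assms(3)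
    by (simp add: compose_bimap_def)
  note \<phi>_simps = \<phi>.bfun_in[unfolded assms(3)] \<phi>.lmom_bfun[unfolded assms(3)]
    \<phi>.rmom_bfun[unfolded assms(3)] \<phi>.bfun_lact[unfolded assms(3)] \<phi>.bfun_ract[unfolded assms(3)]
    \<phi>.same_lgrpd[unfolded assms(3)] \<phi>.same_rgrpd[unfolded assms(3)] \<phi>.src.lact_in \<phi>.src.ract_in
  note \<psi>_simps = \<psi>.same_lgrpd \<psi>.same_rgrpd \<psi>.lmom_bfun \<psi>.rmom_bfun \<psi>.bfun_lact \<psi>.bfun_ract
  show ?thesis
    by (intro biequivariant_smooth_map.intro)
      (simp_all add: \<phi>_simps \<psi>_simps smooth \<phi>.bsrc \<psi>.btrg)
qed

lemma bsrc_bimap_hcomp [simp]: "bsrc (bimap_hcomp \<phi> \<psi>) = bsrc \<phi> \<odot> bsrc \<psi>"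
  and btrg_bimap_hcomp [simp]: "btrg (bimap_hcomp \<phi> \<psi>) = btrg \<phi> \<odot> btrg \<psi>"
  by (simp_all add: bimap_hcomp_def rename_bimap_def tensor_bimap_def bibundle_comp_def)

text \<open>
  The horizontal composite \<open>\<phi> \<otimes> \<psi>\<close> is the map \<open>x \<otimes> y \<mapsto> \<phi>x \<otimes> \<psi>y\<close>; sliding \<open>h\<close> across the first tensor sign becomes
  sliding \<open>h\<close> across the second one by equivariance of \<open>\<phi>\<close> and \<open>\<psi>\<close>.
\<close>

locale composable_bimaps =
  \<phi>: biequivariant_smooth_map \<phi> + \<psi>: biequivariant_smooth_map \<psi>
  for \<phi> \<psi> :: "'u ubimap" +
  assumes infinite: "infinite (UNIV :: 'u set)"
    and mid: "rgrpd (bsrc \<phi>) = lgrpd (bsrc \<psi>)"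
begin

sublocale src: composable_bibundles "bsrc \<phi>" "bsrc \<psi>"
  by (rule composable_bibundles.intro[OF \<phi>.bsrc \<psi>.bsrc]) (simp add: composable_bibundles_axioms_def infinite mid)

sublocale trg: composable_bibundles "btrg \<phi>" "btrg \<psi>"
  by (rule composable_bibundles.intro[OF \<phi>.btrg \<psi>.btrg])
    (simp add: composable_bibundles_axioms_def infinite mid \<phi>.same_rgrpd[symmetric] \<psi>.same_lgrpd[symmetric])

lemmas rep_simps = \<phi>.bfun_in \<psi>.bfun_in \<phi>.lmom_bfun \<psi>.lmom_bfun \<phi>.rmom_bfun \<psi>.rmom_bfun
  \<phi>.bfun_lact \<psi>.bfun_lact \<phi>.bfun_ract \<psi>.bfun_ract
  \<phi>.same_lgrpd[symmetric] \<phi>.same_rgrpd[symmetric] \<psi>.same_lgrpd[symmetric] \<psi>.same_rgrpd[symmetric] mid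

lemma bfun_hcomp:
  assumes xy: "x \<in> pts (bsrc \<phi>)" "y \<in> pts (bsrc \<psi>)" "rmom (bsrc \<phi>) x = lmom (bsrc \<psi>) y"
  shows "bfun (bimap_hcomp \<phi> \<psi>) (x \<otimes>\<^bsub>bsrc \<phi>,bsrc \<psi>\<^esub> y) =
    bfun \<phi> x \<otimes>\<^bsub>btrg \<phi>,btrg \<psi>\<^esub> bfun \<psi> y"
proof -
  have tens: "tens (bsrc \<phi>) (bsrc \<psi>) x y \<in> points (tensor_space (bsrc \<phi>) (bsrc \<psi>))"
    using xy by (auto simp: src.in_points_tensor_space)
  have "induced (\<lambda>(x, y). tens (btrg \<phi>) (btrg \<psi>) (bfun \<phi> x) (bfun \<psi> y)) (tens (bsrc \<phi>) (bsrc \<psi>) x y) =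
      tens (btrg \<phi>) (btrg \<psi>) (bfun \<phi> x) (bfun \<psi> y)"
  proof (subst src.induced_tens[OF xy])
    fix h y'
    assume h: "h \<in> larrs (bsrc \<psi>)" "y' \<in> pts (bsrc \<psi>)"
      "rmom (bsrc \<phi>) x = gtrg (lgrpd (bsrc \<psi>)) h" "gsrc (lgrpd (bsrc \<psi>)) h = lmom (bsrc \<psi>) y'"
      "y = lact (bsrc \<psi>) (h, y')"
    then show "(\<lambda>(x, y). tens (btrg \<phi>) (btrg \<psi>) (bfun \<phi> x) (bfun \<psi> y)) (ract (bsrc \<phi>) (x, h), y') =
        (\<lambda>(x, y). tens (btrg \<phi>) (btrg \<psi>) (bfun \<phi> x) (bfun \<psi> y)) (x, y)"
      using trg.tens_slide[of "bfun \<phi> x" "bfun \<psi> y'" h] xy by (simp add: rep_simps)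
  qed simp
  then show ?thesis
    using tens by (simp add: bimap_hcomp_def rename_bimap_def tensor_bimap_def tensor_bibundle_def
        tensor_point_def src.inv_into_tensor_point[OF xy, unfolded tensor_point_def])
qed

lemma biequivariant_hcomp: "biequivariant_smooth_map (bimap_hcomp \<phi> \<psi>)"
proof -
  interpret map_on_representatives "bsrc \<phi> \<odot> bsrc \<psi>" "btrg \<phi> \<odot> btrg \<psi>"
    "{(x, y). x \<in> pts (bsrc \<phi>) \<and> y \<in> pts (bsrc \<psi>) \<and> rmom (bsrc \<phi>) x = lmom (bsrc \<psi>) y}"
    "\<lambda>(x, y). x \<otimes>\<^bsub>bsrc \<phi>,bsrc \<psi>\<^esub> y" "\<lambda>(x, y). bfun \<phi> x \<otimes>\<^bsub>btrg \<phi>,btrg \<psi>\<^esub> bfun \<psi> y"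
  proof (intro map_on_representatives.intro src.diffeological_bibundle_comp
      trg.diffeological_bibundle_comp map_on_representatives_axioms.intro, goal_cases)
    \<comment> \<open>The goals follow the assumptions of \<open>map_on_representatives\<close>: 3 is surjectivity, 4
      well-definedness, 8 and 9 are the actions, 10 is smoothness.\<close>
    case (3 s)
    then show ?case
      by (auto elim!: src.pts_compE)
  next
    case (4 t t')
    then obtain x y x' y' where t: "t = (x, y)" "t' = (x', y')"
      and xy: "x \<in> pts (bsrc \<phi>)" "y \<in> pts (bsrc \<psi>)" "rmom (bsrc \<phi>) x = lmom (bsrc \<psi>) y"
      and xy': "x' \<in> pts (bsrc \<phi>)" "y' \<in> pts (bsrc \<psi>)" "rmom (bsrc \<phi>) x' = lmom (bsrc \<psi>) y'"
      and eq: "x \<otimes>\<^bsub>bsrc \<phi>,bsrc \<psi>\<^esub> y = x' \<otimes>\<^bsub>bsrc \<phi>,bsrc \<psi>\<^esub> y'"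
      by auto
    from bfun_hcomp[OF xy] bfun_hcomp[OF xy'] eq show ?case
      by (simp add: t)
  next
    case (8 t g)
    then obtain x y where t: "t = (x, y)"
      and xy: "x \<in> pts (bsrc \<phi>)" "y \<in> pts (bsrc \<psi>)" "rmom (bsrc \<phi>) x = lmom (bsrc \<psi>) y"
      by auto
    with 8 show ?case
      by (intro bexI[of _ "(lact (bsrc \<phi>) (g, x), y)"])
        (simp_all add: rep_simps src.comp_simps trg.comp_simps \<phi>.src.element_simps)
  next
    case (9 t h)
    then obtain x y where t: "t = (x, y)"
      and xy: "x \<in> pts (bsrc \<phi>)" "y \<in> pts (bsrc \<psi>)" "rmom (bsrc \<phi>) x = lmom (bsrc \<psi>) y"
      by auto
    with 9 show ?case
      by (intro bexI[of _ "(x, ract (bsrc \<psi>) (y, h))"])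
        (simp_all add: rep_simps src.comp_simps trg.comp_simps \<psi>.src.element_simps)
  next
    case (10 \<alpha> m U u)
    obtain W \<xi> \<eta> where W: "openin (Euclidean_space m) W" "u \<in> W" "W \<subseteq> U"
      and plot: "\<xi> \<in> plots (total (bsrc \<phi>)) m W" "\<eta> \<in> plots (total (bsrc \<psi>)) m W"
      and eq: "\<And>w. w \<in> W \<Longrightarrow> rmom (bsrc \<phi>) (\<xi> w) = lmom (bsrc \<psi>) (\<eta> w)"
        "\<And>w. w \<in> W \<Longrightarrow> \<alpha> w = \<xi> w \<otimes>\<^bsub>bsrc \<phi>,bsrc \<psi>\<^esub> \<eta> w"
      by (rule src.comp_plotE[OF 10]) (rule that)
    have pt: "\<xi> w \<in> pts (bsrc \<phi>)" "\<eta> w \<in> pts (bsrc \<psi>)" if "w \<in> W" for w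
      using \<phi>.src.T.plot_point[OF plot(1) that] \<psi>.src.T.plot_point[OF plot(2) that] by auto
    have "(\<lambda>w\<in>W. (\<lambda>w\<in>W. bfun \<phi> (\<xi> w)) w \<otimes>\<^bsub>btrg \<phi>,btrg \<psi>\<^esub> (\<lambda>w\<in>W. bfun \<psi> (\<eta> w)) w)
        \<in> plots (total (btrg \<phi> \<odot> btrg \<psi>)) m W"
      by (rule trg.tensor_point_plot[OF \<phi>.bfun_plot[OF plot(1)] \<psi>.bfun_plot[OF plot(2)]])
        (simp add: rep_simps pt eq)
    then show ?case
      using W eq pt by (intro exI[of _ W] exI[of _ "\<lambda>w. (\<xi> w, \<eta> w)"]) (simp cong: restrict_cong)
  qed (auto simp: rep_simps src.comp_simps trg.comp_simps)
  show ?thesis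
    by (rule biequivariant_if_agrees) (auto simp: bfun_hcomp, simp add: bimap_hcomp_def
        rename_bimap_def tensor_bimap_def tensor_bibundle_def src.total_comp rename_dspace_def)
qed

end


section \<open>The associator\<close>

definition composable_points ::
  "'u ubibundle \<Rightarrow> 'u ubibundle \<Rightarrow> 'u ubibundle \<Rightarrow> ('u \<times> 'u \<times> 'u) set" where
  "composable_points X Y Z = {(x, y, z). x \<in> pts X \<and> y \<in> pts Y \<and> z \<in> pts Z \<and>
     rmom X x = lmom Y y \<and> rmom Y y = lmom Z z}"

abbreviation left_nested_point ::
  "'u ubibundle \<Rightarrow> 'u ubibundle \<Rightarrow> 'u ubibundle \<Rightarrow> 'u \<times> 'u \<times> 'u \<Rightarrow> 'u" where
  "left_nested_point X Y Z \<equiv> \<lambda>(x, y, z). (x \<otimes>\<^bsub>X,Y\<^esub> y) \<otimes>\<^bsub>X \<odot> Y,Z\<^esub> z"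

abbreviation right_nested_point ::
  "'u ubibundle \<Rightarrow> 'u ubibundle \<Rightarrow> 'u ubibundle \<Rightarrow> 'u \<times> 'u \<times> 'u \<Rightarrow> 'u" where
  "right_nested_point X Y Z \<equiv> \<lambda>(x, y, z). x \<otimes>\<^bsub>X,Y \<odot> Z\<^esub> (y \<otimes>\<^bsub>Y,Z\<^esub> z)"

definition associator :: "'u ubibundle \<Rightarrow> 'u ubibundle \<Rightarrow> 'u ubibundle \<Rightarrow> 'u ubimap" where
  "associator X Y Z = map_by_representatives ((X \<odot> Y) \<odot> Z) (X \<odot> (Y \<odot> Z))
     (composable_points X Y Z) (left_nested_point X Y Z) (right_nested_point X Y Z)"

lemma bsrc_associator [simp]: "bsrc (associator X Y Z) = (X \<odot> Y) \<odot> Z"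
  and btrg_associator [simp]: "btrg (associator X Y Z) = X \<odot> (Y \<odot> Z)"
  by (simp_all add: associator_def)

locale composable_triple =
  XY: composable_bibundles X Y + YZ: composable_bibundles Y Z for X Y Z :: "'u ubibundle"
begin

sublocale XY_Z: composable_bibundles "X \<odot> Y" Z
  by (rule composable_bibundles.intro[OF XY.diffeological_bibundle_comp YZ.Y.diffeological_bibundle_axioms])
    (simp add: composable_bibundles_axioms_def XY.infinite YZ.mid)

sublocale X_YZ: composable_bibundles X "Y \<odot> Z"
  by (rule composable_bibundles.intro[OF XY.X.diffeological_bibundle_axioms YZ.diffeological_bibundle_comp])
    (simp add: composable_bibundles_axioms_def XY.infinite XY.mid)

abbreviation triples where "triples \<equiv> composable_points X Y Z"
abbreviation left_nested where "left_nested \<equiv> left_nested_point X Y Z"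
abbreviation right_nested where "right_nested \<equiv> right_nested_point X Y Z"

lemmas triples_def = composable_points_def

lemmas triple_simps = XY.comp_simps YZ.comp_simps XY_Z.comp_simps X_YZ.comp_simps
  XY.X.element_simps XY.Y.element_simps YZ.Y.element_simps XY.mid YZ.mid

text \<open>
  An equality \<open>(x \<otimes> y) \<otimes> z = (x' \<otimes> y') \<otimes> z'\<close> consists of two slides: an arrow \<open>k\<close> with \<open>x' \<otimes> y' = x \<otimes> yk\<close> and
  \<open>z = kz'\<close>, and then an arrow \<open>h\<close> with \<open>x' = xh\<close> and \<open>yk = hy'\<close>. The same two arrows give
  \<open>x \<otimes> (y \<otimes> kz') = x \<otimes> (yk \<otimes> z') = x \<otimes> h(y' \<otimes> z') = xh \<otimes> (y' \<otimes> z')\<close>.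
\<close>

lemma left_nested_eq_imp:
  assumes "t \<in> triples" "t' \<in> triples" "left_nested t = left_nested t'"
  shows "right_nested t = right_nested t'"
proof -
  note [simp] = triple_simps
  obtain x y z x' y' z' where t: "t = (x, y, z)" "t' = (x', y', z')"
    and xyz: "x \<in> pts X" "y \<in> pts Y" "z \<in> pts Z" "rmom X x = lmom Y y" "rmom Y y = lmom Z z"
    and xyz': "x' \<in> pts X" "y' \<in> pts Y" "z' \<in> pts Z" "rmom X x' = lmom Y y'" "rmom Y y' = lmom Z z'"
    using assms(1,2) by (auto simp: triples_def)
  have "(x \<otimes>\<^bsub>X,Y\<^esub> y) \<otimes>\<^bsub>X \<odot> Y,Z\<^esub> z = (x' \<otimes>\<^bsub>X,Y\<^esub> y') \<otimes>\<^bsub>X \<odot> Y,Z\<^esub> z'"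
    using assms(3) by (simp add: t)
  then obtain k where k: "k \<in> larrs Z" "rmom Y y = gtrg (lgrpd Z) k" "gsrc (lgrpd Z) k = lmom Z z'"
    "x' \<otimes>\<^bsub>X,Y\<^esub> y' = x \<otimes>\<^bsub>X,Y\<^esub> ract Y (y, k)" "z = lact Z (k, z')"
    using XY_Z.tensor_point_eq_iff[of "x \<otimes>\<^bsub>X,Y\<^esub> y" z "x' \<otimes>\<^bsub>X,Y\<^esub> y'" z'] xyz xyz' by auto
  then obtain h where h: "h \<in> larrs Y" "rmom X x = gtrg (lgrpd Y) h" "gsrc (lgrpd Y) h = lmom Y y'"
    "x' = ract X (x, h)" "ract Y (y, k) = lact Y (h, y')"
    using XY.tensor_point_eq_iff[of x "ract Y (y, k)" x' y'] xyz xyz' by auto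
  have "x \<otimes>\<^bsub>X,Y \<odot> Z\<^esub> (y \<otimes>\<^bsub>Y,Z\<^esub> z) = x \<otimes>\<^bsub>X,Y \<odot> Z\<^esub> (ract Y (y, k) \<otimes>\<^bsub>Y,Z\<^esub> z')"
    using YZ.tensor_point_slide[of y z' k] xyz xyz' k by simp
  also have "\<dots> = x \<otimes>\<^bsub>X,Y \<odot> Z\<^esub> lact (Y \<odot> Z) (h, y' \<otimes>\<^bsub>Y,Z\<^esub> z')"
    using xyz xyz' h by simp
  also have "\<dots> = x' \<otimes>\<^bsub>X,Y \<odot> Z\<^esub> (y' \<otimes>\<^bsub>Y,Z\<^esub> z')"
    using X_YZ.tensor_point_slide[of x "y' \<otimes>\<^bsub>Y,Z\<^esub> z'" h] xyz xyz' h by simp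
  finally show ?thesis
    by (simp add: t)
qed

text \<open>
  The converse uses the same two arrows, found in the opposite order.
\<close>

lemma right_nested_eq_imp:
  assumes "t \<in> triples" "t' \<in> triples" "right_nested t = right_nested t'"
  shows "left_nested t = left_nested t'"
proof -
  note [simp] = triple_simps
  obtain x y z x' y' z' where t: "t = (x, y, z)" "t' = (x', y', z')"
    and xyz: "x \<in> pts X" "y \<in> pts Y" "z \<in> pts Z" "rmom X x = lmom Y y" "rmom Y y = lmom Z z"
    and xyz': "x' \<in> pts X" "y' \<in> pts Y" "z' \<in> pts Z" "rmom X x' = lmom Y y'" "rmom Y y' = lmom Z z'"
    using assms(1,2) by (auto simp: triples_def)
  have "x \<otimes>\<^bsub>X,Y \<odot> Z\<^esub> (y \<otimes>\<^bsub>Y,Z\<^esub> z) = x' \<otimes>\<^bsub>X,Y \<odot> Z\<^esub> (y' \<otimes>\<^bsub>Y,Z\<^esub> z')"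
    using assms(3) by (simp add: t)
  then obtain h where h: "h \<in> larrs Y" "rmom X x = gtrg (lgrpd Y) h" "gsrc (lgrpd Y) h = lmom Y y'"
    "x' = ract X (x, h)" "y \<otimes>\<^bsub>Y,Z\<^esub> z = lact Y (h, y') \<otimes>\<^bsub>Y,Z\<^esub> z'"
    using X_YZ.tensor_point_eq_iff[of x "y \<otimes>\<^bsub>Y,Z\<^esub> z" x' "y' \<otimes>\<^bsub>Y,Z\<^esub> z'"] xyz xyz' by auto
  then obtain k where k: "k \<in> larrs Z" "rmom Y y = gtrg (lgrpd Z) k" "gsrc (lgrpd Z) k = lmom Z z'"
    "lact Y (h, y') = ract Y (y, k)" "z = lact Z (k, z')"
    using YZ.tensor_point_eq_iff[of y z "lact Y (h, y')" z'] xyz xyz' by auto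
  have "(x' \<otimes>\<^bsub>X,Y\<^esub> y') \<otimes>\<^bsub>X \<odot> Y,Z\<^esub> z' = (x \<otimes>\<^bsub>X,Y\<^esub> lact Y (h, y')) \<otimes>\<^bsub>X \<odot> Y,Z\<^esub> z'"
    using XY.tensor_point_slide[of x y' h] xyz xyz' h by simp
  also have "\<dots> = ract (X \<odot> Y) (x \<otimes>\<^bsub>X,Y\<^esub> y, k) \<otimes>\<^bsub>X \<odot> Y,Z\<^esub> z'"
    using xyz xyz' k by simp
  also have "\<dots> = (x \<otimes>\<^bsub>X,Y\<^esub> y) \<otimes>\<^bsub>X \<odot> Y,Z\<^esub> z"
    using XY_Z.tensor_point_slide[of "x \<otimes>\<^bsub>X,Y\<^esub> y" z' k] xyz xyz' k by simp
  finally show ?thesis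
    by (simp add: t)
qed

text \<open>
  Two successive local lifts: first to a plot of \<open>X \<odot> Y\<close> and one of \<open>Z\<close>, then, on a smaller domain, to
  plots of all three factors.
\<close>

lemma left_nested_plotE:
  assumes \<alpha>: "\<alpha> \<in> plots (total ((X \<odot> Y) \<odot> Z)) m U" and u: "u \<in> U"
  obtains W \<xi> \<eta> \<zeta> where "openin (Euclidean_space m) W" "u \<in> W" "W \<subseteq> U"
    and "\<xi> \<in> plots (total X) m W" "\<eta> \<in> plots (total Y) m W" "\<zeta> \<in> plots (total Z) m W"
    and "\<And>w. w \<in> W \<Longrightarrow> (\<xi> w, \<eta> w, \<zeta> w) \<in> triples"
    and "\<And>w. w \<in> W \<Longrightarrow> \<alpha> w = left_nested (\<xi> w, \<eta> w, \<zeta> w)"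
proof -
  obtain V \<theta> \<zeta> where V: "openin (Euclidean_space m) V" "u \<in> V" "V \<subseteq> U"
    and \<theta>: "\<theta> \<in> plots (total (X \<odot> Y)) m V" and \<zeta>: "\<zeta> \<in> plots (total Z) m V"
    and eq: "\<And>w. w \<in> V \<Longrightarrow> rmom (X \<odot> Y) (\<theta> w) = lmom Z (\<zeta> w)"
      "\<And>w. w \<in> V \<Longrightarrow> \<alpha> w = \<theta> w \<otimes>\<^bsub>X \<odot> Y,Z\<^esub> \<zeta> w"
    by (rule XY_Z.comp_plotE[OF \<alpha> u]) (rule that)
  obtain W \<xi> \<eta> where W: "openin (Euclidean_space m) W" "u \<in> W" "W \<subseteq> V"
    and plot: "\<xi> \<in> plots (total X) m W" "\<eta> \<in> plots (total Y) m W"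
    and eq': "\<And>w. w \<in> W \<Longrightarrow> rmom X (\<xi> w) = lmom Y (\<eta> w)"
      "\<And>w. w \<in> W \<Longrightarrow> \<theta> w = \<xi> w \<otimes>\<^bsub>X,Y\<^esub> \<eta> w"
    by (rule XY.comp_plotE[OF \<theta> V(2)]) (rule that)
  have pt: "\<xi> w \<in> pts X" "\<eta> w \<in> pts Y" "\<zeta> w \<in> pts Z" "w \<in> V" if "w \<in> W" for w
    using XY.X.T.plot_point[OF plot(1) that] XY.Y.T.plot_point[OF plot(2) that]
      YZ.Y.T.plot_point[OF \<zeta>, of w] W(3) that by auto
  show thesis
  proof (rule that[OF W(1,2) _ plot YZ.Y.T.plot_restrict[OF \<zeta> W(1,3)]])
    fix w assume w: "w \<in> W"
    then show "(\<xi> w, \<eta> w, restrict \<zeta> W w) \<in> triples"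
      using pt[OF w] eq(1)[of w] eq'[OF w] by (simp add: triples_def XY.rmom_comp)
    show "\<alpha> w = left_nested (\<xi> w, \<eta> w, restrict \<zeta> W w)"
      using w pt(4)[OF w] eq(2)[of w] eq'(2)[OF w] by simp
  qed (use W V in auto)
qed

lemma right_nested_plotE:
  assumes \<alpha>: "\<alpha> \<in> plots (total (X \<odot> (Y \<odot> Z))) m U" and u: "u \<in> U"
  obtains W \<xi> \<eta> \<zeta> where "openin (Euclidean_space m) W" "u \<in> W" "W \<subseteq> U"
    and "\<xi> \<in> plots (total X) m W" "\<eta> \<in> plots (total Y) m W" "\<zeta> \<in> plots (total Z) m W"
    and "\<And>w. w \<in> W \<Longrightarrow> (\<xi> w, \<eta> w, \<zeta> w) \<in> triples"
    and "\<And>w. w \<in> W \<Longrightarrow> \<alpha> w = right_nested (\<xi> w, \<eta> w, \<zeta> w)"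
proof -
  obtain V \<xi> \<theta> where V: "openin (Euclidean_space m) V" "u \<in> V" "V \<subseteq> U"
    and \<xi>: "\<xi> \<in> plots (total X) m V" and \<theta>: "\<theta> \<in> plots (total (Y \<odot> Z)) m V"
    and eq: "\<And>w. w \<in> V \<Longrightarrow> rmom X (\<xi> w) = lmom (Y \<odot> Z) (\<theta> w)"
      "\<And>w. w \<in> V \<Longrightarrow> \<alpha> w = \<xi> w \<otimes>\<^bsub>X,Y \<odot> Z\<^esub> \<theta> w"
    by (rule X_YZ.comp_plotE[OF \<alpha> u]) (rule that)
  obtain W \<eta> \<zeta> where W: "openin (Euclidean_space m) W" "u \<in> W" "W \<subseteq> V"
    and plot: "\<eta> \<in> plots (total Y) m W" "\<zeta> \<in> plots (total Z) m W"
    and eq': "\<And>w. w \<in> W \<Longrightarrow> rmom Y (\<eta> w) = lmom Z (\<zeta> w)"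
      "\<And>w. w \<in> W \<Longrightarrow> \<theta> w = \<eta> w \<otimes>\<^bsub>Y,Z\<^esub> \<zeta> w"
    by (rule YZ.comp_plotE[OF \<theta> V(2)]) (rule that)
  have pt: "\<xi> w \<in> pts X" "\<eta> w \<in> pts Y" "\<zeta> w \<in> pts Z" "w \<in> V" if "w \<in> W" for w
    using XY.Y.T.plot_point[OF plot(1) that] YZ.Y.T.plot_point[OF plot(2) that]
      XY.X.T.plot_point[OF \<xi>, of w] W(3) that by auto
  show thesis
  proof (rule that[OF W(1,2) _ XY.X.T.plot_restrict[OF \<xi> W(1,3)] plot])
    fix w assume w: "w \<in> W"
    then show "(restrict \<xi> W w, \<eta> w, \<zeta> w) \<in> triples"
      using pt[OF w] eq(1)[of w] eq'[OF w] by (simp add: triples_def YZ.lmom_comp)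
    show "\<alpha> w = right_nested (restrict \<xi> W w, \<eta> w, \<zeta> w)"
      using w pt(4)[OF w] eq(2)[of w] eq'(2)[OF w] by simp
  qed (use W V in auto)
qed

lemma left_nested_plot:
  assumes "\<xi> \<in> plots (total X) m W" "\<eta> \<in> plots (total Y) m W" "\<zeta> \<in> plots (total Z) m W"
    and t: "\<And>w. w \<in> W \<Longrightarrow> (\<xi> w, \<eta> w, \<zeta> w) \<in> triples"
  shows "(\<lambda>w\<in>W. left_nested (\<xi> w, \<eta> w, \<zeta> w)) \<in> plots (total ((X \<odot> Y) \<odot> Z)) m W"
proof -
  have eq: "\<xi> w \<in> pts X" "\<eta> w \<in> pts Y" "rmom X (\<xi> w) = lmom Y (\<eta> w)" "rmom Y (\<eta> w) = lmom Z (\<zeta> w)"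
    if "w \<in> W" for w
    using t[OF that] by (auto simp: triples_def)
  have "(\<lambda>w\<in>W. (\<lambda>w\<in>W. \<xi> w \<otimes>\<^bsub>X,Y\<^esub> \<eta> w) w \<otimes>\<^bsub>X \<odot> Y,Z\<^esub> \<zeta> w) \<in> plots (total ((X \<odot> Y) \<odot> Z)) m W"
    by (rule XY_Z.tensor_point_plot[OF XY.tensor_point_plot[OF assms(1,2)] assms(3)])
      (simp_all add: eq XY.rmom_comp)
  then show ?thesis
    by (simp cong: restrict_cong)
qed

lemma right_nested_plot:
  assumes "\<xi> \<in> plots (total X) m W" "\<eta> \<in> plots (total Y) m W" "\<zeta> \<in> plots (total Z) m W"
    and t: "\<And>w. w \<in> W \<Longrightarrow> (\<xi> w, \<eta> w, \<zeta> w) \<in> triples"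
  shows "(\<lambda>w\<in>W. right_nested (\<xi> w, \<eta> w, \<zeta> w)) \<in> plots (total (X \<odot> (Y \<odot> Z))) m W"
proof -
  have eq: "\<eta> w \<in> pts Y" "\<zeta> w \<in> pts Z" "rmom X (\<xi> w) = lmom Y (\<eta> w)" "rmom Y (\<eta> w) = lmom Z (\<zeta> w)"
    if "w \<in> W" for w
    using t[OF that] by (auto simp: triples_def)
  have "(\<lambda>w\<in>W. \<xi> w \<otimes>\<^bsub>X,Y \<odot> Z\<^esub> (\<lambda>w\<in>W. \<eta> w \<otimes>\<^bsub>Y,Z\<^esub> \<zeta> w) w) \<in> plots (total (X \<odot> (Y \<odot> Z))) m W"
    by (rule X_YZ.tensor_point_plot[OF assms(1) YZ.tensor_point_plot[OF assms(2,3)]])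
      (simp_all add: eq YZ.lmom_comp)
  then show ?thesis
    by (simp cong: restrict_cong)
qed

sublocale associator: iso_on_representatives "(X \<odot> Y) \<odot> Z" "X \<odot> (Y \<odot> Z)" triples left_nested right_nested
proof (intro iso_on_representatives.intro map_on_representatives.intro
    map_on_representatives_axioms.intro XY_Z.diffeological_bibundle_comp
    X_YZ.diffeological_bibundle_comp, goal_cases)
  \<comment> \<open>The goals follow the assumptions of \<open>map_on_representatives\<close>, 1 to 10 for the map and 11 to 20 for
    its inverse: 3 is surjectivity, 4 well-definedness, 8 and 9 are the actions, 10 is smoothness.\<close>
  case (3 s)
  then show ?case
    by (force simp: triples_def XY.rmom_comp elim!: XY_Z.pts_compE XY.pts_compE)
next
  case (4 t t')
  then show ?case
    by (rule left_nested_eq_imp)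
next
  case (8 t g)
  then obtain x y z where "t = (x, y, z)" by (cases t)
  with 8 show ?case
    by (intro bexI[of _ "(lact X (g, x), y, z)"]) (simp_all add: triples_def triple_simps)
next
  case (9 t h)
  then obtain x y z where "t = (x, y, z)" by (cases t)
  with 9 show ?case
    by (intro bexI[of _ "(x, y, ract Z (z, h))"]) (simp_all add: triples_def triple_simps)
next
  case (10 \<alpha> m U u)
  obtain W \<xi> \<eta> \<zeta> where W: "openin (Euclidean_space m) W" "u \<in> W" "W \<subseteq> U"
    and plot: "\<xi> \<in> plots (total X) m W" "\<eta> \<in> plots (total Y) m W" "\<zeta> \<in> plots (total Z) m W"
    and t: "\<And>w. w \<in> W \<Longrightarrow> (\<xi> w, \<eta> w, \<zeta> w) \<in> triples"
    and eq: "\<And>w. w \<in> W \<Longrightarrow> \<alpha> w = left_nested (\<xi> w, \<eta> w, \<zeta> w)"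
    by (rule left_nested_plotE[OF 10]) (rule that)
  show ?case
    using W t eq right_nested_plot[OF plot t]
    by (intro exI[of _ W] exI[of _ "\<lambda>w. (\<xi> w, \<eta> w, \<zeta> w)"]) simp
next
  case (13 s)
  then show ?case
    by (force simp: triples_def YZ.lmom_comp elim!: X_YZ.pts_compE YZ.pts_compE)
next
  case (14 t t')
  then show ?case
    by (rule right_nested_eq_imp)
next
  case (18 t g)
  then obtain x y z where "t = (x, y, z)" by (cases t)
  with 18 show ?case
    by (intro bexI[of _ "(lact X (g, x), y, z)"]) (simp_all add: triples_def triple_simps)
next
  case (19 t h)
  then obtain x y z where "t = (x, y, z)" by (cases t)
  with 19 show ?case
    by (intro bexI[of _ "(x, y, ract Z (z, h))"]) (simp_all add: triples_def triple_simps)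
next
  case (20 \<alpha> m U u)
  obtain W \<xi> \<eta> \<zeta> where W: "openin (Euclidean_space m) W" "u \<in> W" "W \<subseteq> U"
    and plot: "\<xi> \<in> plots (total X) m W" "\<eta> \<in> plots (total Y) m W" "\<zeta> \<in> plots (total Z) m W"
    and t: "\<And>w. w \<in> W \<Longrightarrow> (\<xi> w, \<eta> w, \<zeta> w) \<in> triples"
    and eq: "\<And>w. w \<in> W \<Longrightarrow> \<alpha> w = right_nested (\<xi> w, \<eta> w, \<zeta> w)"
    by (rule right_nested_plotE[OF 20]) (rule that)
  show ?case
    using W t eq left_nested_plot[OF plot t]
    by (intro exI[of _ W] exI[of _ "\<lambda>w. (\<xi> w, \<eta> w, \<zeta> w)"]) simp
qed (auto simp: triples_def triple_simps)

lemma bfun_associator: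
  assumes "x \<in> pts X" "y \<in> pts Y" "z \<in> pts Z" "rmom X x = lmom Y y" "rmom Y y = lmom Z z"
  shows "bfun (associator X Y Z) ((x \<otimes>\<^bsub>X,Y\<^esub> y) \<otimes>\<^bsub>X \<odot> Y,Z\<^esub> z) = x \<otimes>\<^bsub>X,Y \<odot> Z\<^esub> (y \<otimes>\<^bsub>Y,Z\<^esub> z)"
  using associator.fwd_rep[of "(x, y, z)"] assms by (simp add: triples_def associator_def)

lemmas biequivariant_associator = associator.biequivariant_fwd[folded associator_def]

end


section \<open>The unitors\<close>

lemma identity_bibundle_simps [simp]:
  "lgrpd (identity_bibundle G) = G" "rgrpd (identity_bibundle G) = G"
  "total (identity_bibundle G) = arrs G"
  "lmom (identity_bibundle G) = gtrg G" "rmom (identity_bibundle G) = gsrc G"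
  "lact (identity_bibundle G) = gcomp G" "ract (identity_bibundle G) = gcomp G"
  by (simp_all add: identity_bibundle_def)

lemma (in diffeological_groupoid) diffeological_bibundle_identity:
  "diffeological_bibundle (identity_bibundle G)"
proof -
  have "smooth_left_action G (arrs G) (gtrg G) (gcomp G)"
    by (rule smooth_left_action.intro)
      (simp_all add: smooth_trg smooth_comp trg_comp id_left comp_assoc)
  moreover have "smooth_right_action G (arrs G) (gsrc G) (gcomp G)"
    by (rule smooth_right_action.intro)
      (simp_all add: smooth_src smooth_comp src_comp id_right comp_assoc)
  ultimately show ?thesis
    by (intro diffeological_bibundle.intro)
      (simp_all add: diffeological_groupoid_axioms arrs src_comp trg_comp comp_assoc)
qed

definition left_unitor :: "'u ubibundle \<Rightarrow> 'u ubimap" where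
  "left_unitor X = map_by_representatives (identity_bibundle (lgrpd X) \<odot> X) X
     {(g, x). g \<in> larrs X \<and> x \<in> pts X \<and> gsrc (lgrpd X) g = lmom X x}
     (\<lambda>(g, x). g \<otimes>\<^bsub>identity_bibundle (lgrpd X),X\<^esub> x) (lact X)"

definition right_unitor :: "'u ubibundle \<Rightarrow> 'u ubimap" where
  "right_unitor X = map_by_representatives (X \<odot> identity_bibundle (rgrpd X)) X
     {(x, h). x \<in> pts X \<and> h \<in> rarrs X \<and> rmom X x = gtrg (rgrpd X) h}
     (\<lambda>(x, h). x \<otimes>\<^bsub>X,identity_bibundle (rgrpd X)\<^esub> h) (ract X)"

lemma bsrc_unitor [simp]:
    "bsrc (left_unitor X) = identity_bibundle (lgrpd X) \<odot> X"
    "bsrc (right_unitor X) = X \<odot> identity_bibundle (rgrpd X)"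
  and btrg_unitor [simp]: "btrg (left_unitor X) = X" "btrg (right_unitor X) = X"
  by (simp_all add: left_unitor_def right_unitor_def)

locale bibundle_in_universe = diffeological_bibundle X for X :: "'u ubibundle" +
  assumes infinite: "infinite (UNIV :: 'u set)"
begin

abbreviation left_one where "left_one \<equiv> identity_bibundle (lgrpd X)"
abbreviation right_one where "right_one \<equiv> identity_bibundle (rgrpd X)"

sublocale left_one: composable_bibundles left_one X
  by (rule composable_bibundles.intro[OF L.diffeological_bibundle_identity diffeological_bibundle_axioms])
    (simp add: composable_bibundles_axioms_def infinite)

sublocale right_one: composable_bibundles X right_one
  by (rule composable_bibundles.intro[OF diffeological_bibundle_axioms R.diffeological_bibundle_identity])
    (simp add: composable_bibundles_axioms_def infinite)

lemmas unit_simps = left_one.comp_simps right_one.comp_simps element_simps L.comp_in R.comp_in L.id_in R.id_in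
  lmom_in rmom_in L.src_id R.src_id L.trg_id R.trg_id L.src_comp L.trg_comp R.src_comp R.trg_comp
  LA.act_id RA.act_id LA.act_act RA.act_act L.id_left R.id_right L.trg_in R.src_in lact_ract

text \<open>
  Every point of the composite with an identity bibundle has a representative with an identity arrow,
  which is determined by the value of the unitor. This gives injectivity of the unitors, and it shows
  that their inverses are \<open>x \<mapsto> id \<otimes> x\<close> and \<open>x \<mapsto> x \<otimes> id\<close>.
\<close>

lemma left_one_normal_form:
  assumes "g \<in> larrs X" "x \<in> pts X" "gsrc (lgrpd X) g = lmom X x"
  shows "g \<otimes>\<^bsub>left_one,X\<^esub> x = gid (lgrpd X) (lmom X (lact X (g, x))) \<otimes>\<^bsub>left_one,X\<^esub> lact X (g, x)"
  using left_one.tensor_point_slide[of "gid (lgrpd X) (gtrg (lgrpd X) g)" x g] assms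
  by (simp add: unit_simps)

lemma right_one_normal_form:
  assumes "x \<in> pts X" "h \<in> rarrs X" "rmom X x = gtrg (rgrpd X) h"
  shows "x \<otimes>\<^bsub>X,right_one\<^esub> h = ract X (x, h) \<otimes>\<^bsub>X,right_one\<^esub> gid (rgrpd X) (rmom X (ract X (x, h)))"
  using right_one.tensor_point_slide[of x "gid (rgrpd X) (gsrc (rgrpd X) h)" h] assms
  by (simp add: unit_simps)

sublocale left_unitor: iso_on_representatives "left_one \<odot> X" X
    "{(g, x). g \<in> larrs X \<and> x \<in> pts X \<and> gsrc (lgrpd X) g = lmom X x}"
    "\<lambda>(g, x). g \<otimes>\<^bsub>left_one,X\<^esub> x" "lact X"
proof (intro iso_on_representatives.intro map_on_representatives.intro
    map_on_representatives_axioms.intro left_one.diffeological_bibundle_comp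
    diffeological_bibundle_axioms, goal_cases)
  \<comment> \<open>The goals follow the assumptions of \<open>map_on_representatives\<close>, 1 to 10 for the map and 11 to 20 for
    its inverse: 3 is surjectivity, 4 well-definedness, 8 and 9 are the actions, 10 is smoothness.\<close>
  case (3 s)
  then show ?case
    by (force elim!: left_one.pts_compE)
next
  case (4 t t')
  then obtain g x g' x' where t: "t = (g, x)" "t' = (g', x')"
    and gx: "g \<in> larrs X" "x \<in> pts X" "gsrc (lgrpd X) g = lmom X x"
    and gx': "g' \<in> larrs X" "x' \<in> pts X" "gsrc (lgrpd X) g' = lmom X x'"
    by auto
  moreover from 4 t have "g \<otimes>\<^bsub>left_one,X\<^esub> x = g' \<otimes>\<^bsub>left_one,X\<^esub> x'"
    by simp
  ultimately obtain h where "h \<in> larrs X" "gsrc (lgrpd X) g = gtrg (lgrpd X) h"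
    "gsrc (lgrpd X) h = lmom X x'" "g' = gcomp (lgrpd X) (g, h)" "x = lact X (h, x')"
    using left_one.tensor_point_eq_iff[of g x g' x'] by auto
  then show ?case
    using gx gx' LA.act_act[of h g x'] by (simp add: t)
next
  case (8 t g)
  then obtain h x where "t = (h, x)" by (cases t)
  with 8 show ?case
    by (intro bexI[of _ "(gcomp (lgrpd X) (g, h), x)"]) (auto simp: unit_simps)
next
  case (9 t k)
  then obtain h x where "t = (h, x)" by (cases t)
  with 9 show ?case
    by (intro bexI[of _ "(h, ract X (x, k))"]) (auto simp: unit_simps)
next
  case (10 \<alpha> m U u)
  obtain W \<gamma> \<xi> where W: "openin (Euclidean_space m) W" "u \<in> W" "W \<subseteq> U"
    and plot: "\<gamma> \<in> plots (total left_one) m W" "\<xi> \<in> plots (total X) m W"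
    and eq: "\<And>w. w \<in> W \<Longrightarrow> rmom left_one (\<gamma> w) = lmom X (\<xi> w)"
      "\<And>w. w \<in> W \<Longrightarrow> \<alpha> w = \<gamma> w \<otimes>\<^bsub>left_one,X\<^esub> \<xi> w"
    by (rule left_one.comp_plotE[OF 10]) (rule that)
  have "(\<lambda>w\<in>W. lact X (\<gamma> w, \<xi> w)) \<in> plots (total X) m W"
    by (rule lact_plot) (use plot eq in simp_all)
  then show ?case
    using W eq left_one.X.T.plot_point[OF plot(1)] T.plot_point[OF plot(2)]
    by (intro exI[of _ W] exI[of _ "\<lambda>w. (\<gamma> w, \<xi> w)"]) simp
next
  case (13 x)
  then show ?case
    by (intro bexI[of _ "(gid (lgrpd X) (lmom X x), x)"]) (simp_all add: unit_simps)
next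
  case (14 t t')
  then obtain g x g' x' where t: "t = (g, x)" "t' = (g', x')"
    and gx: "g \<in> larrs X" "x \<in> pts X" "gsrc (lgrpd X) g = lmom X x"
    and gx': "g' \<in> larrs X" "x' \<in> pts X" "gsrc (lgrpd X) g' = lmom X x'"
    by auto
  show ?case
    using 14(3) left_one_normal_form[OF gx] left_one_normal_form[OF gx'] by (simp add: t)
next
  case (18 t g)
  then obtain h x where "t = (h, x)" by (cases t)
  with 18 show ?case
    by (intro bexI[of _ "(gcomp (lgrpd X) (g, h), x)"]) (auto simp: unit_simps)
next
  case (19 t k)
  then obtain h x where "t = (h, x)" by (cases t)
  with 19 show ?case
    by (intro bexI[of _ "(h, ract X (x, k))"]) (auto simp: unit_simps)
next
  case (20 \<alpha> m U u)
  have pt: "\<alpha> u \<in> pts X" if "u \<in> U" for u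
    using T.plot_point[OF 20(1) that] .
  have "(\<lambda>u\<in>U. gid (lgrpd X) (lmom X (\<alpha> u))) \<in> plots (total left_one) m U"
    using smooth_plot[OF L.smooth_id smooth_plot[OF LA.smooth_moment 20(1)]]
    by (simp cong: restrict_cong)
  from left_one.tensor_point_plot[OF this 20(1)]
  have "(\<lambda>u\<in>U. gid (lgrpd X) (lmom X (\<alpha> u)) \<otimes>\<^bsub>left_one,X\<^esub> \<alpha> u) \<in> plots (total (left_one \<odot> X)) m U"
    by (simp add: pt unit_simps cong: restrict_cong)
  then show ?case
    using 20(2) T.plot_open[OF 20(1)]
    by (intro exI[of _ U] exI[of _ "\<lambda>u. (gid (lgrpd X) (lmom X (\<alpha> u)), \<alpha> u)"])
      (simp add: pt unit_simps cong: restrict_cong)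
qed (auto simp: unit_simps)

sublocale right_unitor: iso_on_representatives "X \<odot> right_one" X
    "{(x, h). x \<in> pts X \<and> h \<in> rarrs X \<and> rmom X x = gtrg (rgrpd X) h}"
    "\<lambda>(x, h). x \<otimes>\<^bsub>X,right_one\<^esub> h" "ract X"
proof (intro iso_on_representatives.intro map_on_representatives.intro
    map_on_representatives_axioms.intro right_one.diffeological_bibundle_comp
    diffeological_bibundle_axioms, goal_cases)
  \<comment> \<open>The goals follow the assumptions of \<open>map_on_representatives\<close>, 1 to 10 for the map and 11 to 20 for
    its inverse: 3 is surjectivity, 4 well-definedness, 8 and 9 are the actions, 10 is smoothness.\<close>
  case (3 s)
  then show ?case
    by (force elim!: right_one.pts_compE)
next
  case (4 t t')
  then obtain x h x' h' where t: "t = (x, h)" "t' = (x', h')"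
    and xh: "x \<in> pts X" "h \<in> rarrs X" "rmom X x = gtrg (rgrpd X) h"
    and xh': "x' \<in> pts X" "h' \<in> rarrs X" "rmom X x' = gtrg (rgrpd X) h'"
    by auto
  moreover from 4 t have "x \<otimes>\<^bsub>X,right_one\<^esub> h = x' \<otimes>\<^bsub>X,right_one\<^esub> h'"
    by simp
  ultimately obtain k where "k \<in> rarrs X" "rmom X x = gtrg (rgrpd X) k"
    "gsrc (rgrpd X) k = gtrg (rgrpd X) h'" "x' = ract X (x, k)" "h = gcomp (rgrpd X) (k, h')"
    using right_one.tensor_point_eq_iff[of x h x' h'] by auto
  then show ?case
    using xh xh' RA.act_act[of x k h'] by (simp add: t)
next
  case (8 t g)
  then obtain x h where "t = (x, h)" by (cases t)
  with 8 show ?case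
    by (intro bexI[of _ "(lact X (g, x), h)"]) (auto simp: unit_simps)
next
  case (9 t k)
  then obtain x h where "t = (x, h)" by (cases t)
  with 9 show ?case
    by (intro bexI[of _ "(x, gcomp (rgrpd X) (h, k))"]) (auto simp: unit_simps)
next
  case (10 \<alpha> m U u)
  obtain W \<xi> \<gamma> where W: "openin (Euclidean_space m) W" "u \<in> W" "W \<subseteq> U"
    and plot: "\<xi> \<in> plots (total X) m W" "\<gamma> \<in> plots (total right_one) m W"
    and eq: "\<And>w. w \<in> W \<Longrightarrow> rmom X (\<xi> w) = lmom right_one (\<gamma> w)"
      "\<And>w. w \<in> W \<Longrightarrow> \<alpha> w = \<xi> w \<otimes>\<^bsub>X,right_one\<^esub> \<gamma> w"
    by (rule right_one.comp_plotE[OF 10]) (rule that)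
  have "(\<lambda>w\<in>W. ract X (\<xi> w, \<gamma> w)) \<in> plots (total X) m W"
    by (rule ract_plot) (use plot eq in simp_all)
  then show ?case
    using W eq right_one.Y.T.plot_point[OF plot(2)] T.plot_point[OF plot(1)]
    by (intro exI[of _ W] exI[of _ "\<lambda>w. (\<xi> w, \<gamma> w)"]) simp
next
  case (13 x)
  then show ?case
    by (intro bexI[of _ "(x, gid (rgrpd X) (rmom X x))"]) (simp_all add: unit_simps)
next
  case (14 t t')
  then obtain x h x' h' where t: "t = (x, h)" "t' = (x', h')"
    and xh: "x \<in> pts X" "h \<in> rarrs X" "rmom X x = gtrg (rgrpd X) h"
    and xh': "x' \<in> pts X" "h' \<in> rarrs X" "rmom X x' = gtrg (rgrpd X) h'"
    by auto
  show ?case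
    using 14(3) right_one_normal_form[OF xh] right_one_normal_form[OF xh'] by (simp add: t)
next
  case (18 t g)
  then obtain x h where "t = (x, h)" by (cases t)
  with 18 show ?case
    by (intro bexI[of _ "(lact X (g, x), h)"]) (auto simp: unit_simps)
next
  case (19 t k)
  then obtain x h where "t = (x, h)" by (cases t)
  with 19 show ?case
    by (intro bexI[of _ "(x, gcomp (rgrpd X) (h, k))"]) (auto simp: unit_simps)
next
  case (20 \<alpha> m U u)
  have pt: "\<alpha> u \<in> pts X" if "u \<in> U" for u
    using T.plot_point[OF 20(1) that] .
  have "(\<lambda>u\<in>U. gid (rgrpd X) (rmom X (\<alpha> u))) \<in> plots (total right_one) m U"
    using smooth_plot[OF R.smooth_id smooth_plot[OF RA.smooth_moment 20(1)]]
    by (simp cong: restrict_cong)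
  from right_one.tensor_point_plot[OF 20(1) this]
  have "(\<lambda>u\<in>U. \<alpha> u \<otimes>\<^bsub>X,right_one\<^esub> gid (rgrpd X) (rmom X (\<alpha> u))) \<in> plots (total (X \<odot> right_one)) m U"
    by (simp add: pt unit_simps cong: restrict_cong)
  then show ?case
    using 20(2) T.plot_open[OF 20(1)]
    by (intro exI[of _ U] exI[of _ "\<lambda>u. (\<alpha> u, gid (rgrpd X) (rmom X (\<alpha> u)))"])
      (simp add: pt unit_simps cong: restrict_cong)
qed (auto simp: unit_simps)

lemma bfun_left_unitor:
  assumes "g \<in> larrs X" "x \<in> pts X" "gsrc (lgrpd X) g = lmom X x"
  shows "bfun (left_unitor X) (g \<otimes>\<^bsub>left_one,X\<^esub> x) = lact X (g, x)"
  using left_unitor.fwd_rep[of "(g, x)"] assms by (simp add: left_unitor_def)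

lemma bfun_right_unitor:
  assumes "x \<in> pts X" "h \<in> rarrs X" "rmom X x = gtrg (rgrpd X) h"
  shows "bfun (right_unitor X) (x \<otimes>\<^bsub>X,right_one\<^esub> h) = ract X (x, h)"
  using right_unitor.fwd_rep[of "(x, h)"] assms by (simp add: right_unitor_def)

lemmas biequivariant_left_unitor = left_unitor.biequivariant_fwd[folded left_unitor_def]
  and biequivariant_right_unitor = right_unitor.biequivariant_fwd[folded right_unitor_def]

end


section \<open>Coherence\<close>

context
  assumes infinite: "infinite (UNIV :: 'u set)"
begin

lemma composable_bibundlesI:
  fixes X Y :: "'u ubibundle"
  assumes "diffeological_bibundle X" "diffeological_bibundle Y" "rgrpd X = lgrpd Y"
  shows "composable_bibundles X Y"
  using assms infinite by (simp add: composable_bibundles_def composable_bibundles_axioms_def)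

lemma composable_tripleI:
  fixes X Y Z :: "'u ubibundle"
  assumes "diffeological_bibundle X" "diffeological_bibundle Y" "diffeological_bibundle Z"
    and "rgrpd X = lgrpd Y" "rgrpd Y = lgrpd Z"
  shows "composable_triple X Y Z"
  using assms by (simp add: composable_triple_def composable_bibundlesI)

lemma composable_bimapsI:
  fixes \<phi> \<psi> :: "'u ubimap"
  assumes "biequivariant_smooth_map \<phi>" "biequivariant_smooth_map \<psi>" "rgrpd (bsrc \<phi>) = lgrpd (bsrc \<psi>)"
  shows "composable_bimaps \<phi> \<psi>"
  using assms infinite by (simp add: composable_bimaps_def composable_bimaps_axioms_def)

lemma bfun_hcomp_tensor_point:
  fixes \<phi> \<psi> :: "'u ubimap"
  assumes "biequivariant_smooth_map \<phi>" "biequivariant_smooth_map \<psi>" "rgrpd X = lgrpd Y"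
    and "bsrc \<phi> = X" "bsrc \<psi> = Y" "x \<in> pts X" "y \<in> pts Y" "rmom X x = lmom Y y"
  shows "bfun (bimap_hcomp \<phi> \<psi>) (x \<otimes>\<^bsub>X,Y\<^esub> y) = bfun \<phi> x \<otimes>\<^bsub>btrg \<phi>,btrg \<psi>\<^esub> bfun \<psi> y"
  using composable_bimaps.bfun_hcomp[OF composable_bimapsI[OF assms(1,2)], of x y] assms by simp

lemmas biequivariant_bimap_hcomp = composable_bimaps.biequivariant_hcomp[OF composable_bimapsI]

lemma hcomp_identity_bimap:
  fixes X Y :: "'u ubibundle"
  assumes "diffeological_bibundle X" "diffeological_bibundle Y" "rgrpd X = lgrpd Y"
  shows "bimap_hcomp (identity_bimap X) (identity_bimap Y) = identity_bimap (X \<odot> Y)"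
proof -
  interpret composable_bibundles X Y
    by (rule composable_bibundlesI[OF assms])
  show ?thesis
  proof (rule bimap_eqI)
    fix p assume "p \<in> pts (bsrc (identity_bimap (X \<odot> Y)))"
    then have "p \<in> pts (X \<odot> Y)" by simp
    then show "bfun (bimap_hcomp (identity_bimap X) (identity_bimap Y)) p =
        bfun (identity_bimap (X \<odot> Y)) p"
      by (rule pts_compE)
        (simp add: bfun_hcomp_tensor_point biequivariant_identity_bimap assms)
  qed (simp_all add: biequivariant_bimap_hcomp biequivariant_identity_bimap
      diffeological_bibundle_comp assms)
qed

text \<open>
  Both sides send \<open>x \<otimes> y\<close> to \<open>\<phi>'\<phi>x \<otimes> \<psi>'\<psi>y\<close>.
\<close>

lemma interchange_bimap:
  fixes \<phi> \<phi>' \<psi> \<psi>' :: "'u ubimap"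
  assumes "biequivariant_smooth_map \<phi>" "biequivariant_smooth_map \<phi>'" "btrg \<phi> = bsrc \<phi>'"
    and "biequivariant_smooth_map \<psi>" "biequivariant_smooth_map \<psi>'" "btrg \<psi> = bsrc \<psi>'"
    and mid: "rgrpd (bsrc \<phi>) = lgrpd (bsrc \<psi>)"
  shows "bimap_hcomp (compose_bimap \<phi>' \<phi>) (compose_bimap \<psi>' \<psi>) =
    compose_bimap (bimap_hcomp \<phi>' \<psi>') (bimap_hcomp \<phi> \<psi>)"
proof -
  interpret \<phi>: biequivariant_smooth_map \<phi> by fact
  interpret \<psi>: biequivariant_smooth_map \<psi> by fact
  interpret composable_bibundles "bsrc \<phi>" "bsrc \<psi>"
    by (rule composable_bibundlesI[OF \<phi>.bsrc \<psi>.bsrc mid])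
  note in_trg = \<phi>.bfun_in[unfolded assms(3)] \<psi>.bfun_in[unfolded assms(6)]
    \<phi>.rmom_bfun[unfolded assms(3)] \<psi>.lmom_bfun[unfolded assms(6)]
  have mid': "rgrpd (bsrc \<phi>') = lgrpd (bsrc \<psi>')"
    using mid \<phi>.same_rgrpd \<psi>.same_lgrpd assms(3,6) by simp
  show ?thesis
  proof (rule bimap_eqI)
    fix p assume "p \<in> pts (bsrc (compose_bimap (bimap_hcomp \<phi>' \<psi>') (bimap_hcomp \<phi> \<psi>)))"
    then have "p \<in> pts (bsrc \<phi> \<odot> bsrc \<psi>)" by simp
    then show "bfun (bimap_hcomp (compose_bimap \<phi>' \<phi>) (compose_bimap \<psi>' \<psi>)) p =
        bfun (compose_bimap (bimap_hcomp \<phi>' \<psi>') (bimap_hcomp \<phi> \<psi>)) p"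
      by (rule pts_compE)
        (simp add: bfun_hcomp_tensor_point biequivariant_compose_bimap assms mid' in_trg)
  qed (simp_all add: biequivariant_bimap_hcomp biequivariant_compose_bimap assms mid')
qed

text \<open>
  Both sides send \<open>(x \<otimes> y) \<otimes> z\<close> to \<open>\<phi>x \<otimes> (\<psi>y \<otimes> \<theta>z)\<close>.
\<close>

lemma associator_natural:
  fixes \<phi> \<psi> \<theta> :: "'u ubimap"
  assumes \<phi>: "biequivariant_smooth_map \<phi>" and \<psi>: "biequivariant_smooth_map \<psi>"
    and \<theta>: "biequivariant_smooth_map \<theta>"
    and mid: "rgrpd (bsrc \<phi>) = lgrpd (bsrc \<psi>)" "rgrpd (bsrc \<psi>) = lgrpd (bsrc \<theta>)"
  shows "compose_bimap (associator (btrg \<phi>) (btrg \<psi>) (btrg \<theta>)) (bimap_hcomp (bimap_hcomp \<phi> \<psi>) \<theta>) =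
    compose_bimap (bimap_hcomp \<phi> (bimap_hcomp \<psi> \<theta>)) (associator (bsrc \<phi>) (bsrc \<psi>) (bsrc \<theta>))"
proof -
  interpret \<phi>: biequivariant_smooth_map \<phi> by fact
  interpret \<psi>: biequivariant_smooth_map \<psi> by fact
  interpret \<theta>: biequivariant_smooth_map \<theta> by fact
  have mid': "rgrpd (btrg \<phi>) = lgrpd (btrg \<psi>)" "rgrpd (btrg \<psi>) = lgrpd (btrg \<theta>)"
    using mid \<phi>.same_rgrpd \<psi>.same_lgrpd \<psi>.same_rgrpd \<theta>.same_lgrpd by simp_all
  interpret S: composable_triple "bsrc \<phi>" "bsrc \<psi>" "bsrc \<theta>"
    by (rule composable_tripleI[OF \<phi>.bsrc \<psi>.bsrc \<theta>.bsrc mid])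
  interpret T: composable_triple "btrg \<phi>" "btrg \<psi>" "btrg \<theta>"
    by (rule composable_tripleI[OF \<phi>.btrg \<psi>.btrg \<theta>.btrg mid'])
  show ?thesis
  proof (rule bimap_eqI)
    fix p assume "p \<in> pts (bsrc (compose_bimap (bimap_hcomp \<phi> (bimap_hcomp \<psi> \<theta>))
      (associator (bsrc \<phi>) (bsrc \<psi>) (bsrc \<theta>))))"
    then have "p \<in> pts ((bsrc \<phi> \<odot> bsrc \<psi>) \<odot> bsrc \<theta>)" by simp
    then show "bfun (compose_bimap (associator (btrg \<phi>) (btrg \<psi>) (btrg \<theta>)) (bimap_hcomp (bimap_hcomp \<phi> \<psi>) \<theta>)) p =
        bfun (compose_bimap (bimap_hcomp \<phi> (bimap_hcomp \<psi> \<theta>)) (associator (bsrc \<phi>) (bsrc \<psi>) (bsrc \<theta>))) p"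
      by (elim S.XY_Z.pts_compE S.XY.pts_compE)
        (simp add: bfun_hcomp_tensor_point biequivariant_bimap_hcomp \<phi> \<psi> \<theta> mid S.triple_simps
          S.bfun_associator T.bfun_associator \<phi>.bfun_in \<psi>.bfun_in \<theta>.bfun_in
          \<phi>.rmom_bfun \<psi>.lmom_bfun \<psi>.rmom_bfun \<theta>.lmom_bfun)
  qed (simp_all add: biequivariant_bimap_hcomp biequivariant_compose_bimap \<phi> \<psi> \<theta> mid
      S.biequivariant_associator T.biequivariant_associator)
qed

lemma bibundle_in_universeI:
  "diffeological_bibundle X \<Longrightarrow> bibundle_in_universe (X :: 'u ubibundle)"
  using infinite by (simp add: bibundle_in_universe_def bibundle_in_universe_axioms_def)

lemma left_unitor_natural:
  fixes \<phi> :: "'u ubimap"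
  assumes \<phi>: "biequivariant_smooth_map \<phi>"
  shows "compose_bimap (left_unitor (btrg \<phi>))
      (bimap_hcomp (identity_bimap (identity_bibundle (lgrpd (bsrc \<phi>)))) \<phi>) =
    compose_bimap \<phi> (left_unitor (bsrc \<phi>))"
proof -
  interpret \<phi>: biequivariant_smooth_map \<phi> by fact
  interpret S: bibundle_in_universe "bsrc \<phi>" by (rule bibundle_in_universeI[OF \<phi>.bsrc])
  interpret T: bibundle_in_universe "btrg \<phi>" by (rule bibundle_in_universeI[OF \<phi>.btrg])
  note one = biequivariant_identity_bimap[OF S.left_one.X.diffeological_bibundle_axioms]
    biequivariant_identity_bimap[OF T.left_one.X.diffeological_bibundle_axioms]
  show ?thesis
  proof (rule bimap_eqI)
    fix p assume "p \<in> pts (bsrc (compose_bimap \<phi> (left_unitor (bsrc \<phi>))))"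
    then have "p \<in> pts (identity_bibundle (lgrpd (bsrc \<phi>)) \<odot> bsrc \<phi>)" by simp
    then show "bfun (compose_bimap (left_unitor (btrg \<phi>))
          (bimap_hcomp (identity_bimap (identity_bibundle (lgrpd (bsrc \<phi>)))) \<phi>)) p =
        bfun (compose_bimap \<phi> (left_unitor (bsrc \<phi>))) p"
      by (elim S.left_one.pts_compE)
        (simp add: bfun_hcomp_tensor_point one \<phi> S.bfun_left_unitor
          T.bfun_left_unitor[folded \<phi>.same_lgrpd] \<phi>.bfun_in \<phi>.lmom_bfun \<phi>.bfun_lact)
  qed (simp_all add: biequivariant_bimap_hcomp biequivariant_compose_bimap \<phi> one
      S.biequivariant_left_unitor T.biequivariant_left_unitor \<phi>.same_lgrpd)
qed

lemma right_unitor_natural: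
  fixes \<phi> :: "'u ubimap"
  assumes \<phi>: "biequivariant_smooth_map \<phi>"
  shows "compose_bimap (right_unitor (btrg \<phi>))
      (bimap_hcomp \<phi> (identity_bimap (identity_bibundle (rgrpd (bsrc \<phi>))))) =
    compose_bimap \<phi> (right_unitor (bsrc \<phi>))"
proof -
  interpret \<phi>: biequivariant_smooth_map \<phi> by fact
  interpret S: bibundle_in_universe "bsrc \<phi>" by (rule bibundle_in_universeI[OF \<phi>.bsrc])
  interpret T: bibundle_in_universe "btrg \<phi>" by (rule bibundle_in_universeI[OF \<phi>.btrg])
  note one = biequivariant_identity_bimap[OF S.right_one.Y.diffeological_bibundle_axioms]
    biequivariant_identity_bimap[OF T.right_one.Y.diffeological_bibundle_axioms]
  show ?thesis
  proof (rule bimap_eqI)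
    fix p assume "p \<in> pts (bsrc (compose_bimap \<phi> (right_unitor (bsrc \<phi>))))"
    then have "p \<in> pts (bsrc \<phi> \<odot> identity_bibundle (rgrpd (bsrc \<phi>)))" by simp
    then show "bfun (compose_bimap (right_unitor (btrg \<phi>))
          (bimap_hcomp \<phi> (identity_bimap (identity_bibundle (rgrpd (bsrc \<phi>)))))) p =
        bfun (compose_bimap \<phi> (right_unitor (bsrc \<phi>))) p"
      by (elim S.right_one.pts_compE)
        (simp add: bfun_hcomp_tensor_point one \<phi> S.bfun_right_unitor
          T.bfun_right_unitor[folded \<phi>.same_rgrpd] \<phi>.bfun_in \<phi>.rmom_bfun \<phi>.bfun_ract)
  qed (simp_all add: biequivariant_bimap_hcomp biequivariant_compose_bimap \<phi> one
      S.biequivariant_right_unitor T.biequivariant_right_unitor \<phi>.same_rgrpd)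
qed

text \<open>
  Both sides send \<open>((x \<otimes> y) \<otimes> z) \<otimes> v\<close> to \<open>x \<otimes> (y \<otimes> (z \<otimes> v))\<close>.
\<close>

lemma associator_pentagon:
  fixes X Y Z V :: "'u ubibundle"
  assumes dbb: "diffeological_bibundle X" "diffeological_bibundle Y" "diffeological_bibundle Z"
      "diffeological_bibundle V"
    and mid: "rgrpd X = lgrpd Y" "rgrpd Y = lgrpd Z" "rgrpd Z = lgrpd V"
  shows "compose_bimap (associator X Y (Z \<odot> V)) (associator (X \<odot> Y) Z V) =
    compose_bimap (bimap_hcomp (identity_bimap X) (associator Y Z V))
      (compose_bimap (associator X (Y \<odot> Z) V) (bimap_hcomp (associator X Y Z) (identity_bimap V)))"
    (is "?l = ?r")
proof -
  interpret A: composable_triple X Y Z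
    by (rule composable_tripleI) fact+
  interpret B: composable_triple Y Z V
    by (rule composable_tripleI) fact+
  interpret C: composable_triple "X \<odot> Y" Z V
    by (rule composable_tripleI) (simp_all add: dbb mid A.XY.diffeological_bibundle_comp)
  interpret D: composable_triple X "Y \<odot> Z" V
    by (rule composable_tripleI) (simp_all add: dbb mid A.YZ.diffeological_bibundle_comp)
  interpret E: composable_triple X Y "Z \<odot> V"
    by (rule composable_tripleI) (simp_all add: dbb mid B.YZ.diffeological_bibundle_comp)
  note ids = biequivariant_identity_bimap[OF dbb(1)] biequivariant_identity_bimap[OF dbb(4)]
  show ?thesis
  proof (rule bimap_eqI)
    fix p assume "p \<in> pts (bsrc ?r)"
    then have "p \<in> pts (((X \<odot> Y) \<odot> Z) \<odot> V)" by simp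
    then show "bfun ?l p = bfun ?r p"
      by (elim C.XY_Z.pts_compE A.XY_Z.pts_compE A.XY.pts_compE)
        (simp add: bfun_hcomp_tensor_point ids mid A.biequivariant_associator B.biequivariant_associator
          A.bfun_associator B.bfun_associator C.bfun_associator D.bfun_associator E.bfun_associator
          A.triple_simps B.triple_simps C.triple_simps D.triple_simps E.triple_simps)
  qed (simp_all add: biequivariant_bimap_hcomp biequivariant_compose_bimap ids mid
      A.biequivariant_associator B.biequivariant_associator C.biequivariant_associator
      D.biequivariant_associator E.biequivariant_associator)
qed

text \<open>
  The left side sends \<open>(x \<otimes> h) \<otimes> y\<close> to \<open>x \<otimes> hy\<close>, the right side to \<open>xh \<otimes> y\<close>: the triangle identity is the
  sliding relation.
\<close>

lemma unitor_triangle: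
  fixes X Y :: "'u ubibundle"
  assumes dbb: "diffeological_bibundle X" "diffeological_bibundle Y" and mid: "rgrpd X = lgrpd Y"
  shows "compose_bimap (bimap_hcomp (identity_bimap X) (left_unitor Y))
      (associator X (identity_bibundle (rgrpd X)) Y) =
    bimap_hcomp (right_unitor X) (identity_bimap Y)" (is "?l = ?r")
proof -
  interpret X: bibundle_in_universe X by (rule bibundle_in_universeI) fact
  interpret Y: bibundle_in_universe Y by (rule bibundle_in_universeI) fact
  interpret XY: composable_bibundles X Y by (rule composable_bibundlesI) fact+
  interpret A: composable_triple X "identity_bibundle (rgrpd X)" Y
    by (rule composable_tripleI) (simp_all add: dbb mid X.right_one.Y.diffeological_bibundle_axioms
      Y.left_one.X.diffeological_bibundle_axioms)
  note right_one_simps = X.right_one.comp_simps[unfolded mid] X.right_one.tensor_point_in[unfolded mid]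
    A.XY_Z.tensor_point_in[unfolded mid] A.XY_Z.comp_simps[unfolded mid]
  note ids = biequivariant_identity_bimap[OF dbb(1)] biequivariant_identity_bimap[OF dbb(2)]
  show ?thesis
  proof (rule bimap_eqI)
    fix p assume "p \<in> pts (bsrc ?r)"
    then have "p \<in> pts ((X \<odot> identity_bibundle (rgrpd X)) \<odot> Y)" by simp
    then obtain q y where q: "q \<in> pts (X \<odot> identity_bibundle (rgrpd X))"
      and y: "y \<in> pts Y" "rmom (X \<odot> identity_bibundle (rgrpd X)) q = lmom Y y"
      and p: "p = q \<otimes>\<^bsub>X \<odot> identity_bibundle (rgrpd X),Y\<^esub> y"
      by (rule A.XY_Z.pts_compE)
    from q obtain x h where x: "x \<in> pts X" and h: "h \<in> pts (identity_bibundle (rgrpd X))"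
      "rmom X x = lmom (identity_bibundle (rgrpd X)) h"
      and q_eq: "q = x \<otimes>\<^bsub>X,identity_bibundle (rgrpd X)\<^esub> h"
      by (rule X.right_one.pts_compE)
    have xhy: "rmom X x = gtrg (lgrpd Y) h" "gsrc (lgrpd Y) h = lmom Y y" "h \<in> larrs Y"
      using x h y by (simp_all add: q_eq right_one_simps mid)
    have "bfun ?l p = x \<otimes>\<^bsub>X,Y\<^esub> lact Y (h, y)"
      using x y(1) xhy
      by (simp add: p q_eq bfun_hcomp_tensor_point ids Y.biequivariant_left_unitor
        A.bfun_associator[unfolded mid] Y.bfun_left_unitor Y.unit_simps right_one_simps mid)
    also have "\<dots> = ract X (x, h) \<otimes>\<^bsub>X,Y\<^esub> y"
      using XY.tensor_point_slide[of x y h] x y(1) xhy by simp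
    also have "\<dots> = bfun ?r p"
      using x y(1) xhy
      by (simp add: p q_eq bfun_hcomp_tensor_point ids X.biequivariant_right_unitor
        X.bfun_right_unitor[unfolded mid] right_one_simps mid)
    finally show "bfun ?l p = bfun ?r p" .
  qed (simp_all add: biequivariant_bimap_hcomp biequivariant_compose_bimap ids mid
      A.biequivariant_associator[unfolded mid] X.biequivariant_right_unitor Y.biequivariant_left_unitor)
qed

end

theorem theorem5p14:
  assumes "infinite (UNIV :: 'u set)"
  shows "\<exists>assoc lunit runit.
    bicategory
      (Collect diffeological_groupoid :: 'u ugroupoid set)
      (Collect diffeological_bibundle) lgrpd rgrpd identity_bibundle bibundle_comp
      (Collect biequivariant_smooth_map) bsrc btrg identity_bimap compose_bimap bimap_hcomp
      assoc lunit runit"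
proof (intro exI)
  note cell_defs = bicategory_data.iso_cell_def bicategory_data.cell_def
  show "bicategory
      (Collect diffeological_groupoid :: 'u ugroupoid set)
      (Collect diffeological_bibundle) lgrpd rgrpd identity_bibundle bibundle_comp
      (Collect biequivariant_smooth_map) bsrc btrg identity_bimap compose_bimap bimap_hcomp
      associator left_unitor right_unitor"
  proof (rule bicategory.intro, unfold cell_defs mem_Collect_eq, goal_cases)
    \<comment> \<open>The goals are the bicategory axioms, in their order in the locale.\<close>
    case (1 f)
    then show ?case
      by (simp add: diffeological_bibundle.lgrpd diffeological_bibundle.rgrpd)
  next
    case (2 \<phi>)
    then interpret biequivariant_smooth_map \<phi> .
    show ?case
      by (simp add: bsrc btrg same_lgrpd same_rgrpd)
  next
    case (3 f)
    then show ?case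
      by (simp add: biequivariant_identity_bimap)
  next
    case (4 \<phi> f g \<psi> h)
    then show ?case
      by (simp add: biequivariant_compose_bimap)
  next
    case (5 \<phi> f g)
    then interpret biequivariant_smooth_map \<phi> by simp
    show ?case
      using 5 bsrc biequivariant_smooth_map_axioms
      by (intro bimap_eqI) (auto simp: biequivariant_compose_bimap biequivariant_identity_bimap)
  next
    case (6 \<phi> f g)
    then interpret biequivariant_smooth_map \<phi> by simp
    show ?case
      using 6 btrg biequivariant_smooth_map_axioms bfun_in
      by (intro bimap_eqI) (auto simp: biequivariant_compose_bimap biequivariant_identity_bimap)
  next
    case (7 \<phi> f g \<psi> h \<theta> k)
    then interpret biequivariant_smooth_map \<phi> by simp
    show ?case
      using 7 bfun_in
      by (intro bimap_eqI) (auto simp: biequivariant_compose_bimap)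
  next
    case (8 a)
    then show ?case
      by (simp add: diffeological_groupoid.diffeological_bibundle_identity)
  next
    case (9 f g)
    then show ?case
      using composable_bibundles.diffeological_bibundle_comp[OF composable_bibundlesI[OF assms]] by simp
  next
    case (10 \<phi> f f' \<psi> g g')
    then show ?case
      using biequivariant_bimap_hcomp[OF assms, of \<phi> \<psi>] by auto
  next
    case (11 f g)
    then show ?case
      by (intro hcomp_identity_bimap[OF assms])
  next
    case (12 \<phi> f f' \<phi>' f'' \<psi> g g' \<psi>' g'')
    then show ?case
      by (intro interchange_bimap[OF assms]) auto
  next
    case (13 f g h)
    then interpret composable_triple f g h
      by (intro composable_tripleI[OF assms])
    show ?case
      using associator.biequivariant_fwd associator.biequivariant_bwd associator.bwd_fwd associator.fwd_bwd
      by (auto simp: associator_def intro!: exI[of _ associator.bwd])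
  next
    case (14 \<phi> f f' \<psi> g g' \<theta> h h')
    then show ?case
      using associator_natural[OF assms, of \<phi> \<psi> \<theta>] by auto
  next
    case (15 f)
    then interpret bibundle_in_universe f
      by (rule bibundle_in_universeI[OF assms])
    show ?case
      using left_unitor.biequivariant_fwd left_unitor.biequivariant_bwd left_unitor.bwd_fwd left_unitor.fwd_bwd
      by (auto simp: left_unitor_def intro!: exI[of _ left_unitor.bwd])
  next
    case (16 \<phi> f f')
    then show ?case
      using left_unitor_natural[OF assms, of \<phi>] by auto
  next
    case (17 f)
    then interpret bibundle_in_universe f
      by (rule bibundle_in_universeI[OF assms])
    show ?case
      using right_unitor.biequivariant_fwd right_unitor.biequivariant_bwd right_unitor.bwd_fwd right_unitor.fwd_bwd
      by (auto simp: right_unitor_def intro!: exI[of _ right_unitor.bwd])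
  next
    case (18 \<phi> f f')
    then show ?case
      using right_unitor_natural[OF assms, of \<phi>] by auto
  next
    case (19 f g h k)
    then show ?case
      by (intro associator_pentagon[OF assms])
  next
    case (20 f g)
    then show ?case
      by (intro unitor_triangle[OF assms])
  qed
qed

end
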